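(* Let $\mu$ be a probability measure supported on a subset $F$ of $[0,1]$. Let $\mathcal{A}=(q_n)_{n\in\mathbb{N}}$ be a lacunary sequence of natural numbers, i.e. there is a constant $K>1$ with $q_{n+1}/q_n\ge K$ for all $n\in\mathbb{N}$. Let $\gamma\in[0,1]$ and let $\psi:\mathbb{N}\to[0,1]$ be a real, positive function. Suppose there exists a constant $A>2$ such that $$\widehat{\mu}(t)=O\big((\log|t|)^{-A}\big)\quad\text{as } |t|\to\infty.$$ Then for any $\varepsilon>0$, $$R(x,N)=2\Psi(N)+O\Big(\Psi(N)^{2/3}\big(\log(\Psi(N)+2)\big)^{2+\varepsilon}\Big)$$ for $\mu$-almost all $x\in F$, where $\Psi(N):=\sum_{n=1}^N\psi(q_n)$.
   Context: The Fourier transform of $\mu$ is $\widehat{\mu}(t)=\int e^{-2\pi i t x}\,d\mu(x)$ for $t\in\mathbb{R}$. For $\alpha\in\mathbb{R}$, $\|\alpha\|=\min\{|\alpha-m|:m\in\mathbb{Z}\}$ denotes the distance to the nearest integer. The counting function is $R(x,N)=\#\{1\le n\le N:\ \|q_nx-\gamma\|\le\psi(q_n)\}$.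
   Formalization: The formal theorem additionally assumes ψ(q_n) ≤ 1/2 for all n ≥ 1; without such a bound the claim fails, e.g. for Lebesgue measure, q_n = 2^n and ψ = 1, where R(x,N) = N but 2Ψ(N) = 2N. *)

theory Defs
  imports "HOL-Probability.Probability"
begin

definition fourier_transform :: "real measure \<Rightarrow> real \<Rightarrow> complex" where
  "fourier_transform \<mu> t =
     (LINT x|\<mu>. exp (- 2 * complex_of_real pi * \<i> * complex_of_real t * complex_of_real x))"

definition int_dist :: "real \<Rightarrow> real" where
  "int_dist \<alpha> = (INF m::int. \<bar>\<alpha> - of_int m\<bar>)"

text \<open>The infimum is attained, so it is the minimum over the integers.\<close>

lemma int_dist_attained: "\<exists>m::int. int_dist \<alpha> = \<bar>\<alpha> - of_int m\<bar>"
proof -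
  have "int_dist \<alpha> = \<bar>\<alpha> - of_int (round \<alpha>)\<bar>"
    unfolding int_dist_def
  proof (rule cInf_eq_minimum)
    fix y assume "y \<in> range (\<lambda>m::int. \<bar>\<alpha> - of_int m\<bar>)"
    then show "\<bar>\<alpha> - of_int (round \<alpha>)\<bar> \<le> y"
      using round_diff_minimal[of \<alpha>] by auto
  qed simp
  then show ?thesis by blast
qed

text \<open>Sequences are indexed by the positive integers; the value at index \<open>0\<close> plays no role.\<close>

definition lacunary :: "(nat \<Rightarrow> nat) \<Rightarrow> bool" where
  "lacunary q \<longleftrightarrow> (\<exists>K>1. \<forall>n\<ge>1. real (q (Suc n)) / real (q n) \<ge> K)"

definition counting :: "(nat \<Rightarrow> nat) \<Rightarrow> (nat \<Rightarrow> real) \<Rightarrow> real \<Rightarrow> real \<Rightarrow> nat \<Rightarrow> nat" where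
  "counting q \<psi> \<gamma> x N = card {n \<in> {1..N}. int_dist (real (q n) * x - \<gamma>) \<le> \<psi> (q n)}"

definition psi_sum :: "(nat \<Rightarrow> nat) \<Rightarrow> (nat \<Rightarrow> real) \<Rightarrow> nat \<Rightarrow> real" where
  "psi_sum q \<psi> N = (\<Sum>n=1..N. \<psi> (q n))"

end

theory Submission
  imports Defs "HOL-Real_Asymp.Real_Asymp"
begin

text \<open>
  The \<open>n\<close>-th indicator is sandwiched between two trigonometric polynomials of degree \<open>(n + 1)\<^sup>8\<close>:
  convolutions of slightly longer or shorter intervals with the kernel proportional to
  \<open>cos (\<pi> x)\<close> to a large even power. Their means differ from \<open>2 \<psi> (q\<^sub>n)\<close> by a summable amount and
  their coefficients are at most \<open>min (4 s) (1 / k)\<close>, where \<open>s\<close> is the half-length. In the second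
  moment of the sum of the oscillating parts, a pair of frequencies \<open>k q\<^sub>n\<close>, \<open>l q\<^sub>m\<close> with \<open>n \<le> m\<close>
  contributes \<open>O(m^(-A))\<close>, up to coefficients, by the decay of the Fourier transform, unless
  \<open>\<bar>k q\<^sub>n - l q\<^sub>m\<bar> < q\<^sub>n / 2\<close>. The former pairs sum to \<open>O(1)\<close> since \<open>A > 2\<close>; the latter sum to
  \<open>O(\<Psi>(N) + 1)\<close> by lacunarity. So the variance of the counting function is \<open>O(\<Psi>(N) + 1)\<close>, and
  Chebyshev's inequality along \<open>\<Psi>(N) \<approx> j\<^sup>3\<close>, Borel-Cantelli and monotonicity in \<open>N\<close> finish the
  proof.
\<close>

section \<open>Trigonometric majorants and minorants of intervals\<close>

text \<open>Fourier coefficients of an even power of cosine, scaled so that the constant term is 1: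
  the kernel is then a probability density on one period.\<close>

definition cos_kernel_coeff :: "nat \<Rightarrow> nat \<Rightarrow> real" where
  "cos_kernel_coeff M k = real ((2 * M) choose (M + k)) / real ((2 * M) choose M)"

text \<open>The antiderivative, vanishing at 0, of the normalized kernel
  \<open>(2 * cos (pi * x)) ^ (2 * M) / real ((2 * M) choose M)\<close>. Working with it turns
  convolution with an interval into a difference of two values.\<close>

definition cos_kernel_prim :: "nat \<Rightarrow> real \<Rightarrow> real" where
  "cos_kernel_prim M x = x + (\<Sum>k=1..M. cos_kernel_coeff M k * sin (2 * pi * real k * x) / (pi * real k))"

text \<open>Expand \<open>(cis y + cis (- y)) ^ (2 * M)\<close> binomially and take real parts; the
  indices \<open>j\<close> and \<open>2 * M - j\<close> give equal terms, so the lower half folds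
  onto the upper one.\<close>

lemma central_cos_power_expansion:
  "(2 * cos y) ^ (2 * M) =
     real ((2 * M) choose M) + 2 * (\<Sum>k=1..M. real ((2 * M) choose (M + k)) * cos (2 * real k * y))"
proof -
  define f where "f j = real ((2*M) choose j) * cos ((2 * real j - 2 * real M) * y)" for j
  have "complex_of_real ((2 * cos y) ^ (2 * M)) = (cis y + cis (- y)) ^ (2 * M)"
    by (auto simp: complex_eq_iff intro!: arg_cong[where f = "\<lambda>z. z ^ (2*M)"])
  also have "\<dots> = (\<Sum>j\<le>2*M. of_nat ((2*M) choose j) * cis y ^ j * cis (- y) ^ (2*M - j))"
    by (rule binomial_ring)
  also have "\<dots> = (\<Sum>j\<le>2*M. of_nat ((2*M) choose j) * cis ((2 * real j - 2 * real M) * y))"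
  proof (rule sum.cong)
    fix j assume "j \<in> {..2*M}"
    then have "j \<le> 2*M" by simp
    have "cis y ^ j * cis (- y) ^ (2*M - j) = cis (real j * y + real (2*M - j) * (- y))"
      by (simp only: Complex.DeMoivre cis_mult)
    also have "real j * y + real (2*M - j) * (- y) = (2 * real j - 2 * real M) * y"
      using \<open>j \<le> 2*M\<close> by (simp add: of_nat_diff algebra_simps)
    finally show "of_nat ((2*M) choose j) * cis y ^ j * cis (- y) ^ (2*M - j)
      = of_nat ((2*M) choose j) * cis ((2 * real j - 2 * real M) * y)"
      by (simp add: mult.assoc)
  qed simp
  finally have "Re (complex_of_real ((2 * cos y) ^ (2 * M))) =
     Re (\<Sum>j\<le>2*M. of_nat ((2*M) choose j) * cis ((2 * real j - 2 * real M) * y))" by simp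
  then have 1: "(2 * cos y) ^ (2 * M) = (\<Sum>j\<le>2*M. f j)"
    by (simp add: f_def del: of_real_power of_real_mult)
  have "{..2*M} = {..<M} \<union> {M} \<union> {M+1..M+M}" by auto
  then have "(\<Sum>j\<le>2*M. f j) = (\<Sum>j<M. f j) + f M + (\<Sum>j=M+1..M+M. f j)"
    by (simp add: sum.union_disjoint disjoint_iff)
  also have "(\<Sum>j=M+1..M+M. f j) = (\<Sum>k=1..M. f (M + k))"
    using sum.shift_bounds_cl_nat_ivl[of f 1 M M] by (simp add: add.commute)
  also have "(\<Sum>j<M. f j) = (\<Sum>k=1..M. f (M + k))"
  proof (rule sum.reindex_bij_witness[of _ "\<lambda>k. M - k" "\<lambda>j. M - j"])
    fix j assume j: "j \<in> {..<M}"
    then have "(2*M) choose j = (2*M) choose (M + (M - j))"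
      using binomial_symmetric[of j "2*M"] by (simp add: mult_2)
    moreover have "cos ((2 * real j - 2 * real M) * y) = cos ((2 * real (M + (M - j)) - 2 * real M) * y)"
    proof -
      have "(2 * real (M + (M - j)) - 2 * real M) * y = - ((2 * real j - 2 * real M) * y)"
        using j by (simp add: of_nat_diff algebra_simps)
      then show ?thesis by (metis cos_minus)
    qed
    ultimately show "f (M + (M - j)) = f j" unfolding f_def by simp
  qed auto
  finally show ?thesis using 1
    by (simp add: f_def sum_distrib_left)
qed

lemma cos_kernel_coeff_bounds: "0 \<le> cos_kernel_coeff M k" "cos_kernel_coeff M k \<le> 1"
  using binomial_maximum'[of M "M + k"]
  by (auto simp: cos_kernel_coeff_def field_simps)

lemma cos_kernel_prim_deriv:
  "(cos_kernel_prim M has_real_derivative (2 * cos (pi * x)) ^ (2 * M) / real ((2 * M) choose M)) (at x)"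
proof -
  have "(cos_kernel_prim M has_real_derivative 1 + (\<Sum>k=1..M. 2 * cos_kernel_coeff M k * cos (2 * pi * real k * x))) (at x)"
    unfolding cos_kernel_prim_def
    by (auto intro!: derivative_eq_intros sum.cong simp: field_simps)
  moreover have "1 + (\<Sum>k=1..M. 2 * cos_kernel_coeff M k * cos (2 * pi * real k * x)) =
      (2 * cos (pi * x)) ^ (2 * M) / real ((2 * M) choose M)"
    unfolding central_cos_power_expansion cos_kernel_coeff_def
    by (simp add: add_divide_distrib sum_divide_distrib sum_distrib_left mult_ac)
  ultimately show ?thesis by simp
qed

lemma cos_kernel_prim_mono: "x \<le> y \<Longrightarrow> cos_kernel_prim M x \<le> cos_kernel_prim M y"
  by (rule DERIV_nonneg_imp_nondecreasing, assumption)
     (rule exI, rule conjI, rule cos_kernel_prim_deriv, simp add: power_mult)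

lemma cos_kernel_prim_uminus: "cos_kernel_prim M (- x) = - cos_kernel_prim M x"
  by (simp add: cos_kernel_prim_def sum_negf)

lemma sin_2pi_nat_add_int: "sin (2 * pi * real k * (x + of_int m)) = sin (2 * pi * real k * x)"
proof -
  have "2 * pi * real k * (x + of_int m) = 2 * pi * real k * x + of_int (int k * m) * (2 * pi)"
    by (simp add: algebra_simps)
  then show ?thesis by (simp only: sin.plus_of_int[where 'a = real, unfolded of_real_eq_id id_apply])
qed

lemma cos_kernel_prim_add_int: "cos_kernel_prim M (x + of_int m) = cos_kernel_prim M x + of_int m"
  unfolding cos_kernel_prim_def by (simp add: sin_2pi_nat_add_int)

text \<open>Amounts to \<open>sin (pi * y) \<ge> \<eta>\<close>, which follows from
  \<open>sin (pi * z) \<ge> z\<close> on (0, 1/2] and the symmetry of the sine about 1/2.\<close>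

lemma cos_pi_power2_le:
  assumes "0 < \<eta>" "\<eta> \<le> y" "y \<le> 1 - \<eta>"
  shows "(cos (pi * y))\<^sup>2 \<le> 1 - \<eta>\<^sup>2"
proof -
  \<comment> \<open>Up to 1/3 the mean value theorem and cos (pi / 3) = 1/2 give at least 3 z / 2;
    from there to 1/2 the sine is at least sin (pi / 3) \<ge> 1/2 \<ge> z.\<close>
  have *: "z \<le> sin (pi * z)" if "0 < z" "z \<le> 1/2" for z :: real
  proof (cases "z \<le> 1 / 3")
    case True
    have "\<exists>w. 0 < w \<and> w < pi * z \<and> sin (pi * z) - sin 0 = (pi * z - 0) * cos w"
      using that by (intro MVT2) (auto intro!: derivative_eq_intros)
    then obtain w where w: "0 < w" "w < pi * z" "sin (pi * z) = (pi * z) * cos w" by auto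
    have "cos (pi / 3) \<le> cos w"
      using w mult_left_mono[OF True, of pi] pi_gt_zero by (intro cos_monotone_0_pi_le) linarith+
    then have "3 * z * (1 / 2) \<le> pi * z * cos w"
      using pi_gt3 that by (intro mult_mono) (auto simp: cos_60)
    then show ?thesis using w that by simp
  next
    case False
    have "sin (pi / 3) \<le> sin (pi * z)"
      using False that mult_left_mono[of "1/3" z pi] mult_left_mono[of z "1/2" pi] pi_gt_zero
      by (intro sin_monotone_2pi_le) linarith+
    moreover have "1 / 2 \<le> sin (pi / 3)" by (simp add: sin_60)
    ultimately show ?thesis using that by linarith
  qed
  have "\<eta> \<le> sin (pi * y)"
  proof (cases "y \<le> 1/2")
    case True
    then show ?thesis using *[of y] assms by linarith
  next
    case False
    then have "1 - y \<le> sin (pi * (1 - y))" using * assms by auto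
    also have "sin (pi * (1 - y)) = sin (pi * y)"
      by (simp add: algebra_simps sin_diff)
    finally show ?thesis using assms by simp
  qed
  then have "\<eta>\<^sup>2 \<le> (sin (pi * y))\<^sup>2" using assms by (intro power_mono) auto
  then show ?thesis using sin_cos_squared_add[of "pi * y"] by linarith
qed

text \<open>Cube the inequality \<open>u / 3 \<le> exp (u / 3)\<close>. Three powers of
  \<open>u = H ^ 2\<close> are enough to beat the factor \<open>2 * M = 2 * H ^ 4\<close> in the
  tail estimate.\<close>

lemma exp_ge_cube: fixes u :: real assumes "0 \<le> u" shows "u ^ 3 / 27 \<le> exp u"
proof -
  have "(u / 3) ^ 3 \<le> exp (u / 3) ^ 3"
    using assms exp_ge_add_one_self[of "u / 3"] by (intro power_mono) linarith+
  also have "\<dots> = exp u" by (simp flip: exp_of_nat_mult)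
  finally show ?thesis by (simp add: power_divide)
qed

text \<open>On this interval the kernel is at most 2 M exp (- M \<eta>^2), by the lower bound for
  the central binomial coefficient. The choice \<open>M = H ^ 4\<close> makes the exponent -H^2, and
  the cubic bound for the exponential leaves 2 H^4 * 27 / H^6.\<close>

lemma cos_kernel_prim_tail:
  assumes "2 \<le> H" and M: "M = H ^ 4" and \<eta>: "\<eta> = 1 / real H"
  shows "cos_kernel_prim M (1 - \<eta>) - cos_kernel_prim M \<eta> \<le> 54 / (real H)\<^sup>2"
proof -
  have H: "real H \<ge> 2" "real H > 0" using assms(1) by auto
  have \<eta>': "0 < \<eta>" "\<eta> \<le> 1/2" using H by (auto simp: \<eta> field_simps)
  have M0: "M > 0" using assms(1) by (simp add: M)
  have bd: "(2 * cos (pi * x)) ^ (2 * M) / real ((2 * M) choose M) \<le> 54 / (real H)\<^sup>2"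
    if x: "\<eta> \<le> x" "x \<le> 1 - \<eta>" for x
  proof -
    have "(cos (pi * x))\<^sup>2 \<le> 1 - \<eta>\<^sup>2" using cos_pi_power2_le[OF \<eta>'(1) x] .
    also have "\<dots> \<le> exp (- (\<eta>\<^sup>2))" using exp_ge_add_one_self[of "- (\<eta>\<^sup>2)"] by simp
    finally have "((cos (pi * x))\<^sup>2) ^ M \<le> exp (- (\<eta>\<^sup>2)) ^ M" by (intro power_mono) auto
    also have "\<dots> = exp (- (real M * \<eta>\<^sup>2))" by (simp add: exp_of_nat_mult[symmetric])
    also have "real M * \<eta>\<^sup>2 = (real H)\<^sup>2" using H by (simp add: M \<eta> field_simps power2_eq_square power4_eq_xxxx)
    also have "exp (- (real H)\<^sup>2) \<le> 27 / (real H) ^ 6"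
      using exp_ge_cube[of "(real H)\<^sup>2"] H by (simp add: exp_minus field_simps power_mult[symmetric])
    finally have c: "((cos (pi * x))\<^sup>2) ^ M \<le> 27 / (real H) ^ 6" .
    have "4 ^ M / (2 * real M) \<le> real ((2 * M) choose M)"
      using central_binomial_lower_bound[OF M0] by simp
    then have b: "4 ^ M / real ((2 * M) choose M) \<le> 2 * real M" using M0 by (simp add: field_simps)
    have "(2 * cos (pi * x)) ^ (2 * M) / real ((2 * M) choose M)
        = (4 ^ M / real ((2 * M) choose M)) * ((cos (pi * x))\<^sup>2) ^ M"
      by (simp add: power_mult power_mult_distrib)
    also have "\<dots> \<le> (2 * real M) * (27 / (real H) ^ 6)" using b c by (intro mult_mono) auto
    also have "\<dots> = 54 / (real H)\<^sup>2" using H by (simp add: M field_simps flip: power_add)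
    finally show ?thesis .
  qed
  have "\<exists>z. \<eta> < z \<and> z < 1 - \<eta> \<and> cos_kernel_prim M (1 - \<eta>) - cos_kernel_prim M \<eta> =
    ((1 - \<eta>) - \<eta>) * ((2 * cos (pi * z)) ^ (2 * M) / real ((2 * M) choose M))" if "\<eta> < 1 - \<eta>"
    by (rule MVT2[OF that]) (rule cos_kernel_prim_deriv)
  then show ?thesis
  proof (cases "\<eta> < 1 - \<eta>")
    case True
    then obtain z where z: "\<eta> < z" "z < 1 - \<eta>" "cos_kernel_prim M (1 - \<eta>) - cos_kernel_prim M \<eta> =
      ((1 - \<eta>) - \<eta>) * ((2 * cos (pi * z)) ^ (2 * M) / real ((2 * M) choose M))"
      using \<open>\<eta> < 1 - \<eta> \<Longrightarrow> _\<close> by blast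
    have "\<dots> \<le> 1 * (54 / (real H)\<^sup>2)"
      using bd[of z] z True \<eta>' by (intro mult_mono) (auto simp: power_mult)
    then show ?thesis using z(3) by simp
  next
    \<comment> \<open>Here \<open>\<eta> = 1 / 2\<close>, so the interval degenerates to a
      point.\<close>
    case False
    then show ?thesis using \<eta>' cos_kernel_prim_mono[of "1-\<eta>" \<eta> M] by (smt (verit) divide_nonneg_nonneg zero_le_power2)
  qed
qed

section \<open>Smoothed intervals as majorants and minorants\<close>

text \<open>For \<open>h > 0\<close> this is the 1-periodic extension of the interval [-h, h]
  convolved with the kernel. Negative \<open>h\<close> also occurs: a short interval may be
  shortened past zero length in the minorant.\<close>

definition cos_window :: "nat \<Rightarrow> real \<Rightarrow> real \<Rightarrow> real" where
  "cos_window M h x = cos_kernel_prim M (x + h) - cos_kernel_prim M (x - h)"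

text \<open>The Fourier coefficient sin (2 pi k h) / (pi k) of the interval times that of the
  kernel; the factor 2 joins the frequencies k and -k.\<close>

definition window_coeff :: "nat \<Rightarrow> real \<Rightarrow> nat \<Rightarrow> real" where
  "window_coeff M h k = 2 * cos_kernel_coeff M k * sin (2 * pi * real k * h) / (pi * real k)"

lemma cos_window_expansion:
  "cos_window M h x = 2 * h + (\<Sum>k=1..M. window_coeff M h k * cos (2 * pi * real k * x))"
proof -
  have "sin (2 * pi * real k * (x + h)) - sin (2 * pi * real k * (x - h))
    = 2 * sin (2 * pi * real k * h) * cos (2 * pi * real k * x)" for k
    by (simp add: ring_distribs sin_add sin_diff)
  then have "cos_kernel_coeff M k * sin (2 * pi * real k * (x + h)) / (pi * real k)
     - cos_kernel_coeff M k * sin (2 * pi * real k * (x - h)) / (pi * real k)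
     = window_coeff M h k * cos (2 * pi * real k * x)" for k
    by (simp add: window_coeff_def flip: diff_divide_distrib right_diff_distrib)
  then show ?thesis
    unfolding cos_window_def cos_kernel_prim_def by (simp add: sum_subtractf[symmetric])
qed

text \<open>The kernel coefficient is at most 1. Bounding the sine by its argument gives the first
  entry of the minimum, bounding it by 1 gives the second.\<close>

lemma window_coeff_bound:
  assumes "k \<ge> 1"
  shows "\<bar>window_coeff M h k\<bar> \<le> min (4 * \<bar>h\<bar>) (1 / real k)"
proof -
  have e: "\<bar>window_coeff M h k\<bar> = cos_kernel_coeff M k * (2 * \<bar>sin (2 * pi * real k * h)\<bar> / (pi * real k))"
    using cos_kernel_coeff_bounds[of M k] by (simp add: window_coeff_def abs_mult)
  have "\<dots> \<le> 1 * (2 * \<bar>sin (2 * pi * real k * h)\<bar> / (pi * real k))"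
    using cos_kernel_coeff_bounds[of M k] by (intro mult_right_mono) auto
  then have l: "\<bar>window_coeff M h k\<bar> \<le> 2 * \<bar>sin (2 * pi * real k * h)\<bar> / (pi * real k)" using e by simp
  also have "\<dots> \<le> 2 * \<bar>2 * pi * real k * h\<bar> / (pi * real k)"
    by (intro divide_right_mono mult_left_mono abs_sin_le_one abs_sin_x_le_abs_x) auto
  also have "\<dots> = 4 * \<bar>h\<bar>" using assms by (simp add: abs_mult)
  finally have 1: "\<bar>window_coeff M h k\<bar> \<le> 4 * \<bar>h\<bar>" .
  have "2 * \<bar>sin (2 * pi * real k * h)\<bar> / (pi * real k) \<le> 2 * 1 / (2 * real k)"
    using pi_gt3 assms by (intro frac_le mult_left_mono abs_sin_le_one mult_right_mono) auto
  then have "\<bar>window_coeff M h k\<bar> \<le> 1 / real k" using l by simp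
  with 1 show ?thesis by simp
qed

lemma cos_window_add_int: "cos_window M h (x + of_int m) = cos_window M h x"
proof -
  have "x + of_int m + h = (x + h) + of_int m" "x + of_int m - h = (x - h) + of_int m" by (simp_all add: algebra_simps)
  then show ?thesis unfolding cos_window_def by (simp only: cos_kernel_prim_add_int)
qed

lemma int_dist_le: "int_dist x \<le> \<bar>x - of_int m\<bar>"
  unfolding int_dist_def by (rule cInf_lower) (auto intro!: bdd_belowI[of _ 0])

text \<open>If x is within r of an integer, the interval lengthened by \<eta> on each side still
  covers [-\<eta>, \<eta>], where the kernel has mass at least 1 - 54 / H^2. Otherwise nonnegativity
  of the window suffices.\<close>

lemma window_majorant:
  assumes "2 \<le> H" "M = H ^ 4" "\<eta> = 1 / real H" "r \<ge> 0"
  shows "of_bool (int_dist x \<le> r) \<le> cos_window M (r + \<eta>) x + 54 / (real H)\<^sup>2"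
proof (cases "int_dist x \<le> r")
  case True
  obtain m :: int where m: "int_dist x = \<bar>x - of_int m\<bar>" using int_dist_attained by blast
  define y where "y = x - of_int m"
  have y: "\<bar>y\<bar> \<le> r" using True m by (simp add: y_def)
  \<comment> \<open>By periodicity and oddness the mass on [-\<eta>, \<eta>] is 1 minus the tail
    mass on [\<eta>, 1 - \<eta>].\<close>
  have "cos_kernel_prim M (1 - \<eta>) = cos_kernel_prim M (- \<eta> + of_int 1)" by simp
  also have "\<dots> = - cos_kernel_prim M \<eta> + 1" using cos_kernel_prim_add_int[of M "-\<eta>" 1] cos_kernel_prim_uminus[of M \<eta>] by simp
  finally have "1 - 54 / (real H)\<^sup>2 \<le> 2 * cos_kernel_prim M \<eta>"
    using cos_kernel_prim_tail[OF assms(1-3)] by linarith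
  also have "\<dots> = cos_kernel_prim M \<eta> - cos_kernel_prim M (- \<eta>)" by (simp add: cos_kernel_prim_uminus)
  also have "\<dots> \<le> cos_window M (r + \<eta>) y"
    unfolding cos_window_def using y by (intro diff_mono cos_kernel_prim_mono) auto
  also have "\<dots> = cos_window M (r + \<eta>) x"
    using cos_window_add_int[of M "r+\<eta>" y m] by (simp add: y_def)
  finally show ?thesis using True by simp
next
  case False
  have "cos_window M (r + \<eta>) x \<ge> 0"
    unfolding cos_window_def using assms by (simp add: cos_kernel_prim_mono)
  then show ?thesis using False by simp
qed

text \<open>As \<open>r \<le> 1 / 2\<close>, the shortened interval fits into one period, so the
  window never exceeds 1. If x is farther than r from every integer, the interval stays, modulo 1,
  within [\<eta>, 1 - \<eta>] and sees only tail mass. Both comparisons use only monotonicity of the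
  primitive, so they also cover \<open>r < \<eta>\<close>.\<close>

lemma window_minorant:
  assumes "2 \<le> H" "M = H ^ 4" "\<eta> = 1 / real H" "r \<le> 1 / 2"
  shows "cos_window M (r - \<eta>) x - 54 / (real H)\<^sup>2 \<le> of_bool (int_dist x \<le> r)"
proof (cases "int_dist x \<le> r")
  case True
  have "cos_window M (r - \<eta>) x \<le> cos_kernel_prim M (x - (r - \<eta>) + of_int 1) - cos_kernel_prim M (x - (r - \<eta>))"
    unfolding cos_window_def using assms
    by (intro diff_mono cos_kernel_prim_mono) (auto intro: order_trans[of _ 1])
  then have "cos_window M (r - \<eta>) x \<le> 1" using cos_kernel_prim_add_int[of M "x - (r - \<eta>)" 1] by simp
  then show ?thesis using True by (smt (verit) divide_nonneg_nonneg of_bool_eq(2) zero_le_power2)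
next
  case False
  define y where "y = x - of_int \<lfloor>x\<rfloor>"
  have "y > r" using int_dist_le[of x "\<lfloor>x\<rfloor>"] False unfolding y_def by linarith
  moreover have "1 - y > r" using int_dist_le[of x "\<lfloor>x\<rfloor> + 1"] False unfolding y_def of_int_add of_int_1 by linarith
  ultimately have "cos_window M (r - \<eta>) y \<le> cos_kernel_prim M (1 - \<eta>) - cos_kernel_prim M \<eta>"
    unfolding cos_window_def by (intro diff_mono cos_kernel_prim_mono) auto
  also have "\<dots> \<le> 54 / (real H)\<^sup>2" using cos_kernel_prim_tail[OF assms(1-3)] .
  also have "cos_window M (r - \<eta>) y = cos_window M (r - \<eta>) x"
    using cos_window_add_int[of M "r-\<eta>" y "\<lfloor>x\<rfloor>"] by (simp add: y_def)
  finally show ?thesis using False by simp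
qed

section \<open>Sums over pairs of frequencies\<close>

text \<open>The summand is t^2 up to l = u / t and (u / l)^2 beyond, and each range contributes
  about t u. A telescoping majorant treats both at once.\<close>

lemma sum_min_power2_le:
  fixes t u :: real
  assumes "0 \<le> t" "0 \<le> u"
  shows "(\<Sum>l=1..L. (min t (u / real l))\<^sup>2) \<le> 4 * t * u"
proof (cases "t = 0 \<or> u = 0")
  case True
  then have "min t (u / real l) = 0" for l using assms by auto
  then show ?thesis using True by auto
next
  case False
  with assms have pos: "t > 0" "u > 0" by auto
  define g where "g l = 4 * t * u\<^sup>2 / (u + t * real l)" for l
  \<comment> \<open>The minimum is at most the harmonic mean, here 2 t u / (u + t (l + 1)). After
    squaring, replacing l + 1 by l in one denominator factor yields a difference of consecutive
    values of \<open>g\<close>.\<close>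
  have step: "(min t (u / real (Suc l)))\<^sup>2 \<le> g l - g (Suc l)" for l
  proof -
    have p: "u + t * real l > 0" "u + t * real (Suc l) > 0"
      using pos by (auto intro: add_pos_nonneg)
    have "min t (u / real (Suc l)) \<le> 2 * t * u / (u + t * real (Suc l))"
    proof (cases "t * real (Suc l) \<le> u")
      case True
      then have "t * (u + t * real (Suc l)) \<le> t * (2 * u)" using pos by (intro mult_left_mono) auto
      then have "t \<le> 2 * t * u / (u + t * real (Suc l))"
        using p by (simp add: pos_le_divide_eq mult_ac)
      then show ?thesis by linarith
    next
      case False
      then have "u * (u + t * real (Suc l)) \<le> u * (2 * t * real (Suc l))"
        using pos by (intro mult_left_mono) auto
      then have "u / real (Suc l) \<le> 2 * t * u / (u + t * real (Suc l))"
        using p by (simp add: divide_simps mult_ac del: of_nat_Suc)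
      then show ?thesis by linarith
    qed
    then have "(min t (u / real (Suc l)))\<^sup>2 \<le> (2 * t * u / (u + t * real (Suc l)))\<^sup>2"
      using pos by (intro power_mono) auto
    also have "\<dots> = (2 * t * u)\<^sup>2 / ((u + t * real (Suc l)) * (u + t * real (Suc l)))"
      by (simp add: power_divide power2_eq_square)
    also have "\<dots> \<le> (2 * t * u)\<^sup>2 / ((u + t * real l) * (u + t * real (Suc l)))"
      using p pos by (intro divide_left_mono mult_right_mono mult_pos_pos) (auto simp: algebra_simps)
    also have "\<dots> = g l - g (Suc l)"
      using p by (simp add: g_def divide_simps power2_eq_square) (simp add: algebra_simps)
    finally show ?thesis .
  qed
  have "(\<Sum>l=1..L. (min t (u / real l))\<^sup>2) = (\<Sum>l<L. (min t (u / real (Suc l)))\<^sup>2)"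
    by (rule sum.reindex_bij_witness[of _ Suc "\<lambda>l. l - 1"]) auto
  also have "\<dots> \<le> (\<Sum>l<L. g l - g (Suc l))" by (intro sum_mono step)
  also have "\<dots> = g 0 - g L" by (rule sum_lessThan_telescope')
  also have "\<dots> \<le> g 0" using pos by (simp add: g_def)
  also have "g 0 = 4 * t * u" using pos by (simp add: g_def power2_eq_square)
  finally show ?thesis .
qed

text \<open>AM-GM with weight sqrt u: the two sums of squares are at most 4 s u and 4 s', and this
  weight gives both the same factor 2 sqrt u. That factor later becomes geometric decay in the
  distance of the indices.\<close>

lemma sum_min_mult_min_le:
  fixes s s' u :: real
  assumes "0 \<le> s" "0 \<le> s'" "0 < u"
  shows "(\<Sum>l=1..L. min s (u / real l) * min s' (1 / real l)) \<le> 2 * sqrt u * (s + s')"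
proof -
  define w where "w = sqrt u"
  have w: "w > 0" "u = w\<^sup>2" using assms by (auto simp: w_def)
  have amgm: "x * y \<le> x\<^sup>2 / (2 * w) + w * y\<^sup>2 / 2" for x y
  proof -
    have "0 \<le> (x - w * y)\<^sup>2 / (2 * w)" using w by simp
    also have "\<dots> = x\<^sup>2 / (2 * w) + w * y\<^sup>2 / 2 - x * y"
      using w by (simp add: field_simps power2_eq_square)
    finally show ?thesis by simp
  qed
  have "(\<Sum>l=1..L. min s (u / real l) * min s' (1 / real l))
     \<le> (\<Sum>l=1..L. (min s (u / real l))\<^sup>2 / (2 * w) + w * (min s' (1 / real l))\<^sup>2 / 2)"
    by (intro sum_mono amgm)
  also have "\<dots> = (\<Sum>l=1..L. (min s (u / real l))\<^sup>2) / (2 * w) + w * (\<Sum>l=1..L. (min s' (1 / real l))\<^sup>2) / 2"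
    by (simp add: sum.distrib sum_divide_distrib sum_distrib_left)
  also have "\<dots> \<le> (4 * s * u) / (2 * w) + w * (4 * s' * 1) / 2"
    using w assms by (intro add_mono divide_right_mono mult_left_mono sum_min_power2_le) auto
  also have "\<dots> = 2 * w * (s + s')" using w by (simp add: field_simps power2_eq_square)
  finally show ?thesis by (simp add: w_def)
qed

lemma sum_of_bool_le_one:
  assumes "\<And>k k'. k \<in> S \<Longrightarrow> k' \<in> S \<Longrightarrow> P k \<Longrightarrow> P k' \<Longrightarrow> k = k'" "finite S"
  shows "(\<Sum>k\<in>S. of_bool (P k) :: real) \<le> 1"
proof -
  have "(\<Sum>k\<in>S. of_bool (P k) :: real) = real (card (S \<inter> Collect P))"
    using assms(2) by simp
  also have "card (S \<inter> Collect P) \<le> 1"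
    using assms by (intro card_le_Suc0_iff_eq[THEN iffD2, unfolded One_nat_def[symmetric]]) auto
  finally show ?thesis by simp
qed

text \<open>For fixed \<open>l\<close> at most one \<open>k\<close> puts \<open>k q\<close> within \<open>q / 2\<close> of \<open>l q'\<close>, and then \<open>k\<close> is at
  least \<open>l q' / (2 q)\<close>; for all the other pairs the decay of \<open>\<rho>\<close> applies.\<close>

lemma correlation_sum_le:
  fixes a b :: "nat \<Rightarrow> real" and \<rho> :: "real \<Rightarrow> real" and q q' s s' B :: real
  assumes q: "0 < q" "q \<le> q'"
    and a: "\<And>k. k \<ge> 1 \<Longrightarrow> 0 \<le> a k \<and> a k \<le> min s (1 / real k)"
    and b: "\<And>k. k \<ge> 1 \<Longrightarrow> 0 \<le> b k \<and> b k \<le> min s' (1 / real k)"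
    and \<rho>: "\<And>t. 0 \<le> \<rho> t" "\<And>t. \<rho> t \<le> 1"
    and far: "\<And>t. q' / 2 \<le> \<bar>t\<bar> \<Longrightarrow> \<rho> t \<le> B"
    and mid: "\<And>t. q' < 2 * real M * q \<Longrightarrow> q / 2 \<le> \<bar>t\<bar> \<Longrightarrow> \<rho> t \<le> B"
  shows "(\<Sum>k=1..M. \<Sum>l=1..L. a k * b l * (\<rho> (real k * q - real l * q') + \<rho> (real k * q + real l * q')))
     \<le> 2 * B * harm M * harm L + 2 * sqrt (2 * q / q') * (s + s')"
proof -
  define u where "u = 2 * q / q'"
  have u: "u > 0" using q by (simp add: u_def)
  have s: "0 \<le> s" "0 \<le> s'" using a[of 1] b[of 1] by auto
  have B: "0 \<le> B" using \<rho>(1)[of q'] far[of q'] q by simp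
  define P where "P k l \<longleftrightarrow> \<bar>real k * q - real l * q'\<bar> < q / 2" for k l :: nat
  define m where "m l = min s (u / real l) * min s' (1 / real l)" for l :: nat
  have m0: "m l \<ge> 0" for l using s u by (auto simp: m_def)
  have pw: "a k * b l * (\<rho> (real k * q - real l * q') + \<rho> (real k * q + real l * q'))
     \<le> 2 * B * (1 / real k) * (1 / real l) + of_bool (P k l) * m l"
    if kl: "k \<in> {1..M}" "l \<in> {1..L}" for k l
  proof -
    have k: "k \<ge> 1" "l \<ge> 1" using kl by auto
    have ab: "0 \<le> a k * b l" "a k * b l \<le> (1 / real k) * (1 / real l)"
      using a[OF k(1)] b[OF k(2)] by (simp, intro mult_mono) auto
    have lq: "q' \<le> real l * q'" using k q by (simp add: mult_le_cancel_right1)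
    have "\<rho> (real k * q + real l * q') \<le> B"
      using q lq mult_nonneg_nonneg[of "real k" q] by (intro far) linarith
    then have plus: "a k * b l * \<rho> (real k * q + real l * q') \<le> (1 / real k) * (1 / real l) * B"
      using ab \<rho> by (intro mult_mono[of "a k * b l"]) auto
    have minus: "a k * b l * \<rho> (real k * q - real l * q')
        \<le> (1 / real k) * (1 / real l) * B + of_bool (P k l) * m l"
    proof (cases "P k l")
      case True
      have "real l * q' < real k * q + q / 2" using True unfolding P_def by linarith
      moreover have "q / 2 \<le> real l * q' / 2" using lq q by linarith
      ultimately have "real l * q' \<le> 2 * real k * q" by linarith
      then have "1 / real k \<le> u / real l"
        using k q by (simp add: u_def divide_simps mult_ac)
      then have "a k \<le> min s (u / real l)" using a[OF k(1)] by linarith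
      then have "a k * b l \<le> m l" unfolding m_def
        using a[OF k(1)] b[OF k(2)] s u by (intro mult_mono) auto
      then have "a k * b l * \<rho> (real k * q - real l * q') \<le> m l * 1"
        using ab \<rho> m0 by (intro mult_mono[of "a k * b l"]) auto
      then show ?thesis using True B by (auto intro: add_increasing)
    next
      case False
      have "\<rho> (real k * q - real l * q') \<le> B"
      \<comment> \<open>If \<open>k * q\<close> is at most \<open>q' / 2\<close>, the difference
        still has size at least \<open>q' / 2\<close> because \<open>l \<ge> 1\<close>. Otherwise
        \<open>q' < 2 * M * q\<close>, the comparability demanded by \<open>mid\<close>.\<close>
      proof (cases "real k * q \<le> q' / 2")
        case True
        then show ?thesis using lq by (intro far) linarith
      next
        case nle: False
        have "real k * q \<le> real M * q" using kl q by (intro mult_right_mono) auto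
        then have "q' < 2 * real M * q" using nle by linarith
        then show ?thesis using False by (intro mid) (auto simp: P_def)
      qed
      then have "a k * b l * \<rho> (real k * q - real l * q') \<le> (1 / real k) * (1 / real l) * B"
        using ab \<rho> by (intro mult_mono[of "a k * b l"]) auto
      then show ?thesis using False by simp
    qed
    show ?thesis using add_mono[OF minus plus] by (simp add: ring_distribs)
  qed
  have one: "(\<Sum>k=1..M. of_bool (P k l) :: real) \<le> 1" for l
  proof (rule sum_of_bool_le_one)
    fix k k' assume "P k l" "P k' l"
    then have "\<bar>real k * q - real k' * q\<bar> < q" unfolding P_def by linarith
    then have "\<bar>real k - real k'\<bar> * q < 1 * q"
      using q by (simp add: abs_mult flip: left_diff_distrib)
    then have "\<bar>real k - real k'\<bar> < 1" using q by simp
    then show "k = k'" by linarith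
  qed simp
  have "(\<Sum>k=1..M. \<Sum>l=1..L. a k * b l * (\<rho> (real k * q - real l * q') + \<rho> (real k * q + real l * q')))
    \<le> (\<Sum>k=1..M. \<Sum>l=1..L. 2 * B * (1 / real k) * (1 / real l) + of_bool (P k l) * m l)"
    by (intro sum_mono pw) auto
  also have "\<dots> = (\<Sum>k=1..M. \<Sum>l=1..L. 2 * B * (1 / real k) * (1 / real l))
      + (\<Sum>k=1..M. \<Sum>l=1..L. of_bool (P k l) * m l)"
    by (simp only: sum.distrib)
  also have "(\<Sum>k=1..M. \<Sum>l=1..L. 2 * B * (1 / real k) * (1 / real l)) = 2 * B * harm M * harm L"
    unfolding harm_def inverse_eq_divide mult.assoc sum_product by (simp only: sum_distrib_left)
  also have "(\<Sum>k=1..M. \<Sum>l=1..L. of_bool (P k l) * m l) = (\<Sum>l=1..L. (\<Sum>k=1..M. of_bool (P k l)) * m l)"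
    by (subst sum.swap) (simp only: sum_distrib_right)
  also have "\<dots> \<le> (\<Sum>l=1..L. 1 * m l)"
    by (intro sum_mono mult_right_mono one m0)
  also have "\<dots> \<le> 2 * sqrt u * (s + s')"
    using sum_min_mult_min_le[OF s u] by (simp add: m_def)
  finally show ?thesis by (simp add: u_def)
qed

section \<open>Elementary sums over pairs of indices\<close>

text \<open>The exponent is the distance of n and m written so that natural subtraction never
  truncates; each side of n contributes at most one full geometric series.\<close>

lemma sum_power_dist_le:
  fixes \<kappa> :: real
  assumes "0 \<le> \<kappa>" "\<kappa> < 1"
  shows "(\<Sum>m=1..N. \<kappa> ^ (max n m - min n m)) \<le> 2 / (1 - \<kappa>)"
proof -
  have geo: "(\<Sum>j\<in>J. \<kappa> ^ j) \<le> 1 / (1 - \<kappa>)" if "finite J" for J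
    using sum_le_suminf[of "\<lambda>j. \<kappa> ^ j" J] that assms by (simp add: suminf_geometric)
  have part: "(\<Sum>m\<in>S. \<kappa> ^ f m) \<le> 1 / (1 - \<kappa>)" if "finite S" "inj_on f S" for f :: "nat \<Rightarrow> nat" and S
    using geo[of "f ` S"] that by (simp add: sum.reindex)
  have "{1..N} = {m\<in>{1..N}. m < n} \<union> {m\<in>{1..N}. n \<le> m}" by auto
  then have "(\<Sum>m=1..N. \<kappa> ^ (max n m - min n m)) = (\<Sum>m\<in>{m\<in>{1..N}. m < n} \<union> {m\<in>{1..N}. n \<le> m}. \<kappa> ^ (max n m - min n m))"
    by (rule arg_cong)
  also have "\<dots> = (\<Sum>m\<in>{m\<in>{1..N}. m < n}. \<kappa> ^ (max n m - min n m)) + (\<Sum>m\<in>{m\<in>{1..N}. n \<le> m}. \<kappa> ^ (max n m - min n m))"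
    by (intro sum.union_disjoint) auto
  also have "\<dots> \<le> 1 / (1 - \<kappa>) + 1 / (1 - \<kappa>)"
    by (intro add_mono part) (auto simp: inj_on_def)
  finally show ?thesis by simp
qed

text \<open>Each m is the maximum of at most 2 m pairs of positive integers.\<close>

lemma sum_max_le:
  fixes g :: "nat \<Rightarrow> real"
  assumes "\<And>n. g n \<ge> 0"
  shows "(\<Sum>n=1..N. \<Sum>m=1..N. g (max n m)) \<le> 2 * (\<Sum>m=1..N. real m * g m)"
proof -
  have "(\<Sum>n=1..N. \<Sum>m=1..N. g (max n m)) \<le>
      (\<Sum>n=1..N. \<Sum>m=1..N. of_bool (n \<le> m) * g m + of_bool (m \<le> n) * g n)"
    using assms by (intro sum_mono) (auto simp: max_def)
  also have "\<dots> = (\<Sum>n=1..N. \<Sum>m=1..N. of_bool (n \<le> m) * g m) + (\<Sum>n=1..N. \<Sum>m=1..N. of_bool (m \<le> n) * g n)"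
    by (simp only: sum.distrib)
  also have "(\<Sum>n=1..N. \<Sum>m=1..N. of_bool (n \<le> m) * g m) = (\<Sum>n=1..N. \<Sum>m=1..N. of_bool (m \<le> n) * g n)"
    by (rule sum.swap)
  also have "\<dots> = (\<Sum>n=1..N. real n * g n)"
  proof (rule sum.cong)
    fix n assume "n \<in> {1..N}"
    then have "{1..N} \<inter> {m. m \<le> n} = {1..n}" by auto
    then show "(\<Sum>m=1..N. of_bool (m \<le> n) * g n) = real n * g n"
      by (simp flip: sum_distrib_right)
  qed simp
  finally show ?thesis by simp
qed

text \<open>A harmonic number exceeds the logarithm of its index by at most 1, and the logarithm of
  a polynomial in n is dominated by any positive power of n.\<close>

lemma harm_power_bound:
  assumes "\<delta> > 0"
  obtains C where "C > 0" "\<And>n. n \<ge> 1 \<Longrightarrow> harm ((n + 1) ^ p) \<le> C * real n powr \<delta>"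
proof
  define C where "C = 1 + real p * (2 powr \<delta> / \<delta>)"
  show "C > 0" using assms by (auto simp: C_def intro: add_pos_nonneg)
  fix n :: nat assume n: "n \<ge> 1"
  have "harm ((n + 1) ^ p) - ln (real ((n + 1) ^ p)) \<le> harm 1 - ln (real 1)"
    by (rule euler_mascheroni_sequence_decreasing) auto
  then have "harm ((n + 1) ^ p) \<le> 1 + real p * ln (real n + 1)"
    by (simp add: ln_realpow harm_def add_ac)
  moreover have "ln (real n + 1) \<le> (real n + 1) powr \<delta> / \<delta>"
    using assms by (intro ln_powr_bound) auto
  moreover have "(real n + 1) powr \<delta> \<le> (2 * real n) powr \<delta>"
    using n assms by (intro powr_mono2) auto
  ultimately have "harm ((n + 1) ^ p) \<le> 1 + real p * ((2 * real n) powr \<delta> / \<delta>)"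
    using assms by (smt (verit) divide_right_mono mult_left_mono of_nat_0_le_iff)
  also have "\<dots> \<le> real n powr \<delta> + real p * ((2 * real n) powr \<delta> / \<delta>)"
    using n assms ge_one_powr_ge_zero[of "real n" \<delta>] by simp
  also have "\<dots> = C * real n powr \<delta>"
    by (simp add: C_def powr_mult algebra_simps)
  finally show "harm ((n + 1) ^ p) \<le> C * real n powr \<delta>" .
qed

section \<open>Second moments under Fourier decay\<close>

text \<open>Rewrites the condition as a countable disjunction, from which its measurability is
  immediate.\<close>

lemma int_dist_le_iff: "int_dist x \<le> r \<longleftrightarrow> (\<exists>m::int. \<bar>x - of_int m\<bar> \<le> r)"
  using int_dist_attained[of x] int_dist_le[of x] by (metis order_trans)

text \<open>The window without its mean. The degree is \<open>M = H ^ 4\<close> for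
  \<open>H = (n + 1) ^ 2\<close>, so that the changes of length \<open>1 / H\<close> are summable
  over n.\<close>

definition window_osc :: "(nat \<Rightarrow> nat) \<Rightarrow> real \<Rightarrow> (nat \<Rightarrow> real) \<Rightarrow> nat \<Rightarrow> real \<Rightarrow> real" where
  "window_osc q \<gamma> h n x = (\<Sum>k=1..(n + 1) ^ 8. window_coeff ((n + 1) ^ 8) (h n) k *
     cos (2 * pi * real k * (real (q n) * x - \<gamma>)))"

lemma norm_fourier_transform_le_1:
  assumes "prob_space \<mu>"
  shows "norm (fourier_transform \<mu> t) \<le> 1"
proof -
  have "norm (fourier_transform \<mu> t) \<le> (LINT x|\<mu>. norm (exp (- 2 * complex_of_real pi * \<i> * complex_of_real t * complex_of_real x)))"
    unfolding fourier_transform_def by (rule integral_norm_bound)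
  also have "\<dots> = (LINT x|\<mu>. 1)" by (intro Bochner_Integration.integral_cong) (auto simp: norm_exp_eq_Re)
  also have "\<dots> = 1" using prob_space.prob_space[OF assms] by simp
  finally show ?thesis .
qed

text \<open>The decay is expressed through the index: a lacunary sequence grows at least
  geometrically, so log q_n has order at least n and powers of the logarithm become powers of
  n.\<close>

locale fourier_decay = prob_space \<mu> for \<mu> :: "real measure" +
  fixes q :: "nat \<Rightarrow> nat" and K A B :: real
  assumes sets_borel [measurable_cong]: "sets \<mu> = sets borel"
    and K: "K > 1" and A: "A > 2" and B: "B > 0"
    and q_pos: "\<And>n. n \<ge> 1 \<Longrightarrow> q n > 0"
    and q_Suc: "\<And>n. n \<ge> 1 \<Longrightarrow> K * real (q n) \<le> real (q (Suc n))"
    and decay: "\<And>n t. n \<ge> 1 \<Longrightarrow> real (q n) / 2 \<le> \<bar>t\<bar> \<Longrightarrow>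
      norm (fourier_transform \<mu> t) \<le> B * real n powr (- A)"
begin

lemma q_growth: "1 \<le> n \<Longrightarrow> K ^ j * real (q n) \<le> real (q (n + j))"
proof (induction j)
  case (Suc j)
  then have "K * (K ^ j * real (q n)) \<le> K * real (q (n + j))" using K by (intro mult_left_mono) auto
  also have "\<dots> \<le> real (q (Suc (n + j)))" using Suc.prems by (intro q_Suc) auto
  finally show ?case by (simp add: mult.assoc)
qed simp

lemma space_UNIV [simp]: "space \<mu> = UNIV"
  using sets_eq_imp_space_eq[OF sets_borel] by simp

lemma integrable_bounded:
  fixes f :: "real \<Rightarrow> real"
  assumes "f \<in> borel_measurable borel" "\<And>x. \<bar>f x\<bar> \<le> b"
  shows "integrable \<mu> f"
  using assms by (intro integrable_const_bound[of _ b]) (auto simp: measurable_cong_sets[OF sets_borel refl])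

text \<open>The cosine is the real part of \<open>cis \<phi>\<close> times the Fourier character;
  the phase only rotates the transform and leaves its modulus unchanged.\<close>

lemma abs_expectation_cos_le:
  "\<bar>LINT x|\<mu>. cos (2 * pi * t * x - \<phi>)\<bar> \<le> norm (fourier_transform \<mu> t)"
proof -
  define e where "e x = exp (- 2 * complex_of_real pi * \<i> * complex_of_real t * complex_of_real x)" for x
  have e: "e x = cis (- (2 * pi * t * x))" for x
    by (simp add: e_def cis_conv_exp mult_ac)
  have int: "integrable \<mu> e"
  proof (rule integrable_const_bound[of _ 1])
    show "AE x in \<mu>. norm (e x) \<le> 1" by (simp add: e)
    have "continuous_on UNIV e" unfolding e_def by (intro continuous_intros)
    then show "e \<in> borel_measurable \<mu>"
      using borel_measurable_continuous_onI measurable_cong_sets[OF sets_borel refl] by blast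
  qed
  have "(LINT x|\<mu>. cos (2 * pi * t * x - \<phi>)) = (LINT x|\<mu>. Re (cis \<phi> * e x))"
  proof (rule Bochner_Integration.integral_cong)
    fix x
    have "Re (cis \<phi> * e x) = cos (- (2 * pi * t * x - \<phi>))"
      unfolding e cis_mult by simp
    then show "cos (2 * pi * t * x - \<phi>) = Re (cis \<phi> * e x)" by (simp only: cos_minus)
  qed simp
  also have "\<dots> = Re (LINT x|\<mu>. cis \<phi> * e x)" using int by (intro integral_Re) auto
  also have "(LINT x|\<mu>. cis \<phi> * e x) = cis \<phi> * fourier_transform \<mu> t"
    unfolding fourier_transform_def e_def[symmetric] by (intro integral_mult_right_zero)
  also have "\<bar>Re \<dots>\<bar> \<le> norm (cis \<phi> * fourier_transform \<mu> t)" by (rule abs_Re_le_cmod)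
  finally show ?thesis by (simp add: norm_mult)
qed

text \<open>Product-to-sum formula; \<open>\<gamma>\<close> enters only the phases, hence the bound
  is uniform in it.\<close>

lemma abs_expectation_cos_mult_cos_le:
  "\<bar>LINT x|\<mu>. cos (2 * pi * k * (u * x - \<gamma>)) * cos (2 * pi * l * (v * x - \<gamma>))\<bar>
   \<le> (norm (fourier_transform \<mu> (k * u - l * v)) + norm (fourier_transform \<mu> (k * u + l * v))) / 2"
proof -
  have eq: "cos (2 * pi * k * (u * x - \<gamma>)) * cos (2 * pi * l * (v * x - \<gamma>)) =
    (cos (2 * pi * (k * u - l * v) * x - 2 * pi * (k - l) * \<gamma>)
      + cos (2 * pi * (k * u + l * v) * x - 2 * pi * (k + l) * \<gamma>)) / 2" for x
    by (subst cos_times_cos) (simp add: algebra_simps)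
  have int: "integrable \<mu> (\<lambda>x. cos (a * x - b))" for a b
    by (rule integrable_bounded[of _ 1]) auto
  have "(LINT x|\<mu>. cos (2 * pi * k * (u * x - \<gamma>)) * cos (2 * pi * l * (v * x - \<gamma>))) =
     ((LINT x|\<mu>. cos (2 * pi * (k * u - l * v) * x - 2 * pi * (k - l) * \<gamma>)) +
      (LINT x|\<mu>. cos (2 * pi * (k * u + l * v) * x - 2 * pi * (k + l) * \<gamma>))) / 2"
    unfolding eq using int by simp
  then show ?thesis
    using abs_expectation_cos_le[of "k * u - l * v" "2 * pi * (k - l) * \<gamma>"]
      abs_expectation_cos_le[of "k * u + l * v" "2 * pi * (k + l) * \<gamma>"] by simp
qed

lemma window_osc_measurable [measurable]: "window_osc q \<gamma> h n \<in> borel_measurable borel"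
  unfolding window_osc_def by measurable

lemma window_osc_bounded: "\<bar>window_osc q \<gamma> h n x\<bar> \<le> (\<Sum>k=1..(n + 1) ^ 8. \<bar>window_coeff ((n + 1) ^ 8) (h n) k\<bar>)"
  unfolding window_osc_def
  by (rule order_trans[OF sum_abs]) (auto intro!: sum_mono simp: abs_mult mult_left_le)

lemma abs_expectation_window_osc_mult_le:
  "\<bar>LINT x|\<mu>. window_osc q \<gamma> h n x * window_osc q \<gamma> h m x\<bar> \<le>
    (\<Sum>k=1..(n + 1) ^ 8. \<Sum>l=1..(m + 1) ^ 8.
      \<bar>window_coeff ((n + 1) ^ 8) (h n) k\<bar> * \<bar>window_coeff ((m + 1) ^ 8) (h m) l\<bar> *
      (norm (fourier_transform \<mu> (real k * real (q n) - real l * real (q m))) +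
       norm (fourier_transform \<mu> (real k * real (q n) + real l * real (q m))))) / 2"
proof -
  define a where "a k = window_coeff ((n + 1) ^ 8) (h n) k" for k
  define b where "b k = window_coeff ((m + 1) ^ 8) (h m) k" for k
  define f where "f k l x = cos (2 * pi * real k * (real (q n) * x - \<gamma>)) *
      cos (2 * pi * real l * (real (q m) * x - \<gamma>))" for k l :: nat and x
  have int: "integrable \<mu> (f k l)" for k l
    unfolding f_def by (rule integrable_bounded[of _ 1]) (auto simp: abs_mult mult_le_one)
  have "window_osc q \<gamma> h n x * window_osc q \<gamma> h m x = (\<Sum>k=1..(n + 1) ^ 8. \<Sum>l=1..(m + 1) ^ 8. a k * b l * f k l x)" for x
    unfolding window_osc_def sum_product a_def b_def f_def by (intro sum.cong) (auto simp: mult_ac)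
  then have "(LINT x|\<mu>. window_osc q \<gamma> h n x * window_osc q \<gamma> h m x) =
      (\<Sum>k=1..(n + 1) ^ 8. \<Sum>l=1..(m + 1) ^ 8. a k * b l * (LINT x|\<mu>. f k l x))"
    using int by (simp add: Bochner_Integration.integral_sum)
  also have "\<bar>\<dots>\<bar> \<le> (\<Sum>k=1..(n + 1) ^ 8. \<Sum>l=1..(m + 1) ^ 8. \<bar>a k * b l * (LINT x|\<mu>. f k l x)\<bar>)"
    by (rule order_trans[OF sum_abs]) (intro sum_mono sum_abs)
  also have "\<dots> \<le> (\<Sum>k=1..(n + 1) ^ 8. \<Sum>l=1..(m + 1) ^ 8. \<bar>a k\<bar> * \<bar>b l\<bar> *
      ((norm (fourier_transform \<mu> (real k * real (q n) - real l * real (q m))) +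
       norm (fourier_transform \<mu> (real k * real (q n) + real l * real (q m)))) / 2))"
    unfolding abs_mult f_def by (intro sum_mono mult_left_mono abs_expectation_cos_mult_cos_le) auto
  finally show ?thesis by (simp add: a_def b_def sum_divide_distrib)
qed

text \<open>Lacunarity gives \<open>K ^ (m - n) < 2 * (n + 1) ^ 8\<close>, so m - n is at most
  logarithmic in n. The cruder linear bound already allows powers of n to be exchanged for powers of
  m up to a constant.\<close>

lemma close_indices:
  assumes "1 \<le> n" "n \<le> m" "real (q m) < 2 * real ((n + 1) ^ 8) * real (q n)"
  shows "real m \<le> (1 + 9 / ln K) * real n"
proof -
  have "K ^ (m - n) * real (q n) < 2 * real ((n + 1) ^ 8) * real (q n)"
    using q_growth[of n "m - n"] assms by simp
  then have lt: "K ^ (m - n) < 2 * (real n + 1) ^ 8"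
    using q_pos[of n] assms by (simp add: add_ac)
  have "real (m - n) * ln K = ln (K ^ (m - n))" using K by (simp add: ln_realpow)
  also have "\<dots> < ln (2 * (real n + 1) ^ 8)"
    using lt K by (subst ln_less_cancel_iff) (auto intro!: mult_pos_pos zero_less_power add_nonneg_pos)
  also have "\<dots> = ln 2 + 8 * ln (real n + 1)"
    by (subst ln_mult) (auto simp: ln_realpow)
  also have "\<dots> \<le> 1 + 8 * real n"
    using ln_2_less_1 ln_add_one_self_le_self[of "real n"] by (intro add_mono mult_left_mono) (auto simp: add_ac)
  also have "\<dots> \<le> 9 * real n" using assms by simp
  finally have "real (m - n) < 9 * real n / ln K" using K by (simp add: pos_less_divide_eq)
  then show ?thesis using assms by (simp add: of_nat_diff algebra_simps)
qed

text \<open>An application of \<open>correlation_sum_le\<close> with the modulus of the transform as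
  \<open>\<rho>\<close>. The first term comes from frequency pairs where the decay applies, the
  second from nearly equal frequencies, where sqrt (q_n / q_m) is geometrically small.\<close>

lemma window_osc_correlation:
  obtains C where "C > 0" "\<And>\<gamma> h s n m. (\<And>n. n \<ge> 1 \<Longrightarrow> \<bar>h n\<bar> \<le> s n) \<Longrightarrow> 1 \<le> n \<Longrightarrow> n \<le> m \<Longrightarrow>
    \<bar>LINT x|\<mu>. window_osc q \<gamma> h n x * window_osc q \<gamma> h m x\<bar>
      \<le> C * real m powr (- 1 - A / 2) + 8 * (1 / sqrt K) ^ (m - n) * (s n + s m)"
proof -
  define c where "c = 1 + 9 / ln K"
  have c: "c \<ge> 1" using K by (simp add: c_def)
  \<comment> \<open>For comparable indices the decay is known at n but wanted at m, where
    \<open>m \<le> c * n\<close>; this costs the factor \<open>c powr A\<close>.\<close>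
  define B' where "B' = B * c powr A"
  have B': "B' \<ge> B" "B' > 0" using B c A ge_one_powr_ge_zero[of c A] by (auto simp: B'_def)
  \<comment> \<open>With this exponent the two harmonic factors together cost m^((A - 2) / 2), which
    leaves m^(-1 - A / 2), an exponent below -2.\<close>
  obtain C where C: "C > 0" "\<And>n. n \<ge> 1 \<Longrightarrow> harm ((n + 1) ^ 8) \<le> C * real n powr ((A - 2) / 4)"
    using harm_power_bound[of "(A - 2) / 4" 8] A by auto
  show ?thesis
  proof
    show "B' * C\<^sup>2 > 0" using B' C by simp
    fix \<gamma> :: real and h s :: "nat \<Rightarrow> real" and n m :: nat
    assume h: "\<And>n. n \<ge> 1 \<Longrightarrow> \<bar>h n\<bar> \<le> s n" and nm: "1 \<le> n" "n \<le> m"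
    have m1: "1 \<le> m" using nm by simp
    define \<rho> where "\<rho> t = norm (fourier_transform \<mu> t)" for t
    define a where "a k = \<bar>window_coeff ((n + 1) ^ 8) (h n) k\<bar>" for k
    define b where "b k = \<bar>window_coeff ((m + 1) ^ 8) (h m) k\<bar>" for k
    have qq: "0 < real (q n)" "K ^ (m - n) * real (q n) \<le> real (q m)"
      using q_growth[of n "m - n"] q_pos nm by auto
    have K1: "1 \<le> K ^ (m - n)" using K by simp
    then have qle: "real (q n) \<le> real (q m)"
      using qq mult_right_mono[of 1 "K ^ (m - n)" "real (q n)"] by linarith
    have mid: "\<rho> t \<le> B' * real m powr (- A)"
      if t: "real (q m) < 2 * real ((n + 1) ^ 8) * real (q n)" "real (q n) / 2 \<le> \<bar>t\<bar>" for t
    proof -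
      have "real m \<le> c * real n" using close_indices[OF nm t(1)] by (simp add: c_def)
      then have "(c * real n) powr (- A) \<le> real m powr (- A)"
        using A m1 by (intro powr_mono2') auto
      then have "c powr (- A) * real n powr (- A) \<le> real m powr (- A)"
        using c by (simp add: powr_mult)
      then have "real n powr (- A) \<le> c powr A * real m powr (- A)"
        using c mult_left_mono[of "c powr (- A) * real n powr (- A)" "real m powr (- A)" "c powr A"]
        by (simp flip: mult.assoc powr_add)
      then have "B * real n powr (- A) \<le> B * (c powr A * real m powr (- A))"
        using B by (intro mult_left_mono) auto
      then show ?thesis using decay[OF nm(1) t(2)] by (simp add: \<rho>_def B'_def mult.assoc)
    qed
    have far: "\<rho> t \<le> B' * real m powr (- A)" if "real (q m) / 2 \<le> \<bar>t\<bar>" for t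
      using decay[OF m1 that] mult_right_mono[OF B'(1), of "real m powr (- A)"] by (simp add: \<rho>_def)
    have "(\<Sum>k=1..(n + 1) ^ 8. \<Sum>l=1..(m + 1) ^ 8. a k * b l *
       (\<rho> (real k * real (q n) - real l * real (q m)) + \<rho> (real k * real (q n) + real l * real (q m))))
      \<le> 2 * (B' * real m powr (- A)) * harm ((n + 1) ^ 8) * harm ((m + 1) ^ 8)
        + 2 * sqrt (2 * real (q n) / real (q m)) * (4 * s n + 4 * s m)"
    proof (rule correlation_sum_le)
      show "0 \<le> a k \<and> a k \<le> min (4 * s n) (1 / real k)" if "k \<ge> 1" for k
        using window_coeff_bound[OF that, of "(n + 1) ^ 8" "h n"] h[OF nm(1)] by (auto simp: a_def)
      show "0 \<le> b k \<and> b k \<le> min (4 * s m) (1 / real k)" if "k \<ge> 1" for k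
        using window_coeff_bound[OF that, of "(m + 1) ^ 8" "h m"] h[OF m1] by (auto simp: b_def)
    qed (use qq qle mid far norm_fourier_transform_le_1[OF prob_space_axioms] in \<open>auto simp: \<rho>_def\<close>)
    moreover have "\<bar>LINT x|\<mu>. window_osc q \<gamma> h n x * window_osc q \<gamma> h m x\<bar> \<le>
      (\<Sum>k=1..(n + 1) ^ 8. \<Sum>l=1..(m + 1) ^ 8. a k * b l *
       (\<rho> (real k * real (q n) - real l * real (q m)) + \<rho> (real k * real (q n) + real l * real (q m)))) / 2"
      unfolding a_def b_def \<rho>_def by (rule abs_expectation_window_osc_mult_le)
    ultimately have 1: "\<bar>LINT x|\<mu>. window_osc q \<gamma> h n x * window_osc q \<gamma> h m x\<bar> \<le>
       B' * real m powr (- A) * (harm ((n + 1) ^ 8) * harm ((m + 1) ^ 8))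
        + 4 * sqrt (2 * real (q n) / real (q m)) * (s n + s m)"
      by (simp add: algebra_simps)
    have hm: "harm ((m + 1) ^ 8) \<le> C * real m powr ((A - 2) / 4)" using C(2)[OF m1] .
    have "harm ((n + 1) ^ 8) \<le> (harm ((m + 1) ^ 8) :: real)"
      using nm by (intro harm_mono power_mono) auto
    then have "harm ((n + 1) ^ 8) * harm ((m + 1) ^ 8) \<le> (C * real m powr ((A - 2) / 4)) * (C * real m powr ((A - 2) / 4))"
      using hm C(1) by (intro mult_mono) (auto intro: harm_nonneg)
    then have "B' * real m powr (- A) * (harm ((n + 1) ^ 8) * harm ((m + 1) ^ 8)) \<le>
        B' * real m powr (- A) * ((C * real m powr ((A - 2) / 4)) * (C * real m powr ((A - 2) / 4)))"
      using B' by (intro mult_left_mono) auto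
    also have "\<dots> = B' * C\<^sup>2 * (real m powr (- A) * real m powr ((A - 2) / 4) * real m powr ((A - 2) / 4))"
      by (simp add: power2_eq_square)
    also have "real m powr (- A) * real m powr ((A - 2) / 4) * real m powr ((A - 2) / 4) = real m powr (- 1 - A / 2)"
    proof -
      have "- A + (A - 2) / 4 + (A - 2) / 4 = - 1 - A / 2" by (simp add: field_simps)
      then show ?thesis by (simp only: powr_add[symmetric])
    qed
    finally have 2: "B' * real m powr (- A) * (harm ((n + 1) ^ 8) * harm ((m + 1) ^ 8)) \<le> B' * C\<^sup>2 * real m powr (- 1 - A / 2)" .
    \<comment> \<open>The factor 2 is relaxed to 4 so that its square root is an integer.\<close>
    have "2 * real (q n) / real (q m) \<le> 4 * (1 / K ^ (m - n))"
    proof -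
      have "real (q n) / real (q m) \<le> 1 / K ^ (m - n)"
        using qq qle K1 by (simp add: divide_simps mult_ac)
      moreover have "0 \<le> 1 / K ^ (m - n)" using K by simp
      ultimately show ?thesis by linarith
    qed
    then have "sqrt (2 * real (q n) / real (q m)) \<le> sqrt (4 * (1 / K ^ (m - n)))" by simp
    also have "\<dots> = 2 * (1 / sqrt K) ^ (m - n)"
      by (simp add: real_sqrt_mult real_sqrt_divide real_sqrt_power power_divide)
    finally have "4 * sqrt (2 * real (q n) / real (q m)) * (s n + s m) \<le> 4 * (2 * (1 / sqrt K) ^ (m - n)) * (s n + s m)"
      using h[OF nm(1)] h[OF m1] by (intro mult_right_mono mult_left_mono) auto
    also have "\<dots> = 8 * (1 / sqrt K) ^ (m - n) * (s n + s m)" by simp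
    finally have "4 * sqrt (2 * real (q n) / real (q m)) * (s n + s m)
      \<le> 8 * (1 / sqrt K) ^ (m - n) * (s n + s m)" .
    with 1 2 show "\<bar>LINT x|\<mu>. window_osc q \<gamma> h n x * window_osc q \<gamma> h m x\<bar>
      \<le> B' * C\<^sup>2 * real m powr (- 1 - A / 2) + 8 * (1 / sqrt K) ^ (m - n) * (s n + s m)" by linarith
  qed
qed

text \<open>Expand the square into pairs. The first correlation terms depend on the larger index and
  reduce to the sum of m^(-A / 2), convergent as A > 2; the second ones sum geometrically in the
  distance of the indices.\<close>

lemma window_osc_second_moment:
  obtains D where "D > 0" "\<And>\<gamma> h s N. (\<And>n. n \<ge> 1 \<Longrightarrow> \<bar>h n\<bar> \<le> s n) \<Longrightarrow>
    (LINT x|\<mu>. (\<Sum>n=1..N. window_osc q \<gamma> h n x)\<^sup>2) \<le> D * (1 + (\<Sum>n=1..N. s n))"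
proof -
  obtain C where C: "C > 0" "\<And>\<gamma> h s n m. (\<And>n. n \<ge> 1 \<Longrightarrow> \<bar>h n\<bar> \<le> s n) \<Longrightarrow> 1 \<le> n \<Longrightarrow> n \<le> m \<Longrightarrow>
    \<bar>LINT x|\<mu>. window_osc q \<gamma> h n x * window_osc q \<gamma> h m x\<bar>
      \<le> C * real m powr (- 1 - A / 2) + 8 * (1 / sqrt K) ^ (m - n) * (s n + s m)"
    using window_osc_correlation by blast
  define \<kappa> where "\<kappa> = 1 / sqrt K"
  have \<kappa>: "0 < \<kappa>" "\<kappa> < 1" using K by (auto simp: \<kappa>_def)
  define Z where "Z = (\<Sum>m. real m powr (- A / 2))"
  have sm: "summable (\<lambda>m. real m powr (- A / 2))" using A by (subst summable_real_powr_iff) auto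
  have Z: "(\<Sum>m=1..N. real m powr (- A / 2)) \<le> Z" for N
    unfolding Z_def by (intro sum_le_suminf sm) auto
  have Z0: "Z \<ge> 0" using Z[of 0] by simp
  \<comment> \<open>The first terms contribute \<open>2 * C * Z\<close>; each of the two symmetric
    geometric sums contributes 8 * 2 / (1 - \<open>\<kappa>\<close>) times the sum of the
    \<open>s n\<close>.\<close>
  define D where "D = 2 * C * Z + 32 / (1 - \<kappa>)"
  show ?thesis
  proof
    show "D > 0" unfolding D_def using C Z0 \<kappa> by (intro add_nonneg_pos) auto
    fix \<gamma> :: real and h s :: "nat \<Rightarrow> real" and N :: nat
    assume h: "\<And>n. n \<ge> 1 \<Longrightarrow> \<bar>h n\<bar> \<le> s n"
    have s0: "s n \<ge> 0" if "n \<ge> 1" for n using h[OF that] by linarith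
    define E where "E n m = (LINT x|\<mu>. window_osc q \<gamma> h n x * window_osc q \<gamma> h m x)" for n m
    define g where "g m = C * real m powr (- 1 - A / 2)" for m :: nat
    have Ele: "E n m \<le> g (max n m) + (8 * \<kappa> ^ (max n m - min n m) * s n + 8 * \<kappa> ^ (max n m - min n m) * s m)"
      if "1 \<le> n" "1 \<le> m" for n m
    proof (cases "n \<le> m")
      case True
      then show ?thesis using C(2)[of h s n m \<gamma>, OF h that(1) True] unfolding E_def g_def \<kappa>_def
        by (simp add: max_def min_def distrib_left)
    next
      case False
      then have "m \<le> n" "m < n" by simp_all
      then show ?thesis using C(2)[of h s m n \<gamma>, OF h that(2) \<open>m \<le> n\<close>] unfolding E_def g_def \<kappa>_def
        by (simp add: max_def min_def distrib_left mult.commute[of "window_osc q \<gamma> h n _"])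
    qed
    have int: "integrable \<mu> (\<lambda>x. window_osc q \<gamma> h n x * window_osc q \<gamma> h m x)" for n m
      by (rule integrable_bounded) (auto simp: abs_mult intro!: mult_mono window_osc_bounded sum_nonneg)
    have "(LINT x|\<mu>. (\<Sum>n=1..N. window_osc q \<gamma> h n x)\<^sup>2) = (\<Sum>n=1..N. \<Sum>m=1..N. E n m)"
      unfolding power2_eq_square sum_product E_def using int by (simp add: Bochner_Integration.integral_sum)
    also have "\<dots> \<le> (\<Sum>n=1..N. \<Sum>m=1..N. g (max n m) + (8 * \<kappa> ^ (max n m - min n m) * s n + 8 * \<kappa> ^ (max n m - min n m) * s m))"
      by (intro sum_mono Ele) auto
    also have "\<dots> = (\<Sum>n=1..N. \<Sum>m=1..N. g (max n m)) + ((\<Sum>n=1..N. \<Sum>m=1..N. 8 * \<kappa> ^ (max n m - min n m) * s n)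
       + (\<Sum>n=1..N. \<Sum>m=1..N. 8 * \<kappa> ^ (max n m - min n m) * s m))"
      by (simp only: sum.distrib)
    also have "(\<Sum>n=1..N. \<Sum>m=1..N. 8 * \<kappa> ^ (max n m - min n m) * s m) = (\<Sum>n=1..N. \<Sum>m=1..N. 8 * \<kappa> ^ (max n m - min n m) * s n)"
      by (subst sum.swap) (simp only: max.commute min.commute)
    also have "(\<Sum>n=1..N. \<Sum>m=1..N. 8 * \<kappa> ^ (max n m - min n m) * s n) = (\<Sum>n=1..N. 8 * (\<Sum>m=1..N. \<kappa> ^ (max n m - min n m)) * s n)"
      by (simp only: sum_distrib_left sum_distrib_right)
    also have "(\<Sum>n=1..N. 8 * (\<Sum>m=1..N. \<kappa> ^ (max n m - min n m)) * s n) \<le> (\<Sum>n=1..N. 8 * (2 / (1 - \<kappa>)) * s n)"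
      using s0 \<kappa> by (intro sum_mono mult_right_mono mult_left_mono sum_power_dist_le) auto
    also have "\<dots> = 16 / (1 - \<kappa>) * (\<Sum>n=1..N. s n)" by (simp add: sum_distrib_left)
    also have "(\<Sum>n=1..N. \<Sum>m=1..N. g (max n m)) \<le> 2 * (\<Sum>m=1..N. real m * g m)"
      using C by (intro sum_max_le) (simp add: g_def)
    also have "(\<Sum>m=1..N. real m * g m) = C * (\<Sum>m=1..N. real m powr (- A / 2))"
      unfolding sum_distrib_left
    proof (rule sum.cong)
      fix m assume "m \<in> {1..N}"
      then have "real m powr (- A / 2) = real m powr 1 * real m powr (- 1 - A / 2)"
        by (subst powr_add[symmetric]) simp
      then show "real m * g m = C * real m powr (- A / 2)" by (simp add: g_def)
    qed simp
    also have "\<dots> \<le> C * Z" using C Z by simp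
    finally have "(LINT x|\<mu>. (\<Sum>n=1..N. window_osc q \<gamma> h n x)\<^sup>2) \<le> 2 * C * Z + 32 / (1 - \<kappa>) * (\<Sum>n=1..N. s n)"
      by simp
    also have "\<dots> \<le> D * 1 + D * (\<Sum>n=1..N. s n)"
      using C Z0 \<kappa> s0 by (intro add_mono mult_right_mono sum_nonneg) (auto simp: D_def)
    finally show "(LINT x|\<mu>. (\<Sum>n=1..N. window_osc q \<gamma> h n x)\<^sup>2) \<le> D * (1 + (\<Sum>n=1..N. s n))"
      by (simp add: distrib_left)
  qed
qed

end

section \<open>The second moment of the counting function\<close>

text \<open>Telescoping: the induction runs on the sharper bound 1 - 1 / (N + 1).\<close>

lemma sum_inverse_Suc_square_le: "(\<Sum>n=1..N. 1 / (real n + 1)\<^sup>2) \<le> 1"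
proof -
  have "(\<Sum>n=1..N. 1 / (real n + 1)\<^sup>2) \<le> 1 - 1 / (real N + 1)"
  proof (induction N)
    case (Suc N)
    have "1 / (real N + 2)\<^sup>2 \<le> 1 / ((real N + 1) * (real N + 2))"
      unfolding power2_eq_square by (intro divide_left_mono mult_right_mono) auto
    also have "\<dots> = 1 / (real N + 1) - 1 / (real N + 2)" by (simp add: field_simps)
    finally show ?case using Suc.IH by (simp add: add_ac)
  qed simp
  also have "\<dots> \<le> 1" by simp
  finally show ?thesis .
qed

lemma power2_sum3_le: "(a + b + c)\<^sup>2 \<le> 3 * (a\<^sup>2 + b\<^sup>2 + (c::real)\<^sup>2)"
proof -
  have "0 \<le> (a - b)\<^sup>2 + (b - c)\<^sup>2 + (a - c)\<^sup>2" by simp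
  then show ?thesis by (simp add: power2_eq_square algebra_simps)
qed

text \<open>The constant 56 is 54 from the tail, as 54 / H^2 \<le> 54 / H, plus 2 from the mean
  moving from 2 r to 2 (r + \<eta>) or 2 (r - \<eta>).\<close>

lemma window_osc_sandwich:
  assumes n: "n \<ge> 1" and r: "0 \<le> r n" "r n \<le> 1 / 2"
  defines "\<eta> \<equiv> 1 / (real n + 1)\<^sup>2"
  shows "of_bool (int_dist (real (q n) * x - \<gamma>) \<le> r n) - 2 * r n
      \<le> window_osc q \<gamma> (\<lambda>n. r n + 1 / (real n + 1)\<^sup>2) n x + 56 * \<eta>" (is ?U)
    and "window_osc q \<gamma> (\<lambda>n. r n - 1 / (real n + 1)\<^sup>2) n x - 56 * \<eta>
      \<le> of_bool (int_dist (real (q n) * x - \<gamma>) \<le> r n) - 2 * r n" (is ?L)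
proof -
  define H where "H = (n + 1)\<^sup>2"
  define y where "y = real (q n) * x - \<gamma>"
  have "2 ^ 2 \<le> H" unfolding H_def using n by (intro power_mono) auto
  then have H: "2 \<le> H" by simp
  have M: "(n + 1) ^ 8 = H ^ 4" by (simp add: H_def flip: power_mult)
  have rH: "real H = (real n + 1)\<^sup>2" by (simp add: H_def add_ac)
  have \<eta>: "\<eta> = 1 / real H" by (simp add: \<eta>_def rH)
  have "54 / (real H)\<^sup>2 \<le> 54 / real H ^ 1" using H by (intro divide_left_mono power_increasing) auto
  then have \<tau>: "54 / (real H)\<^sup>2 \<le> 54 * \<eta>" by (simp add: \<eta>)
  show ?U
    using window_majorant[OF H M \<eta> r(1), of y] \<tau>
    by (simp add: cos_window_expansion window_osc_def y_def \<eta>_def)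
  show ?L
    using window_minorant[OF H M \<eta> r(2), of y] \<tau>
    by (simp add: cos_window_expansion window_osc_def y_def \<eta>_def)
qed

context fourier_decay
begin

text \<open>Summing the sandwich traps the deviation between two oscillating sums up to an error of
  56, because the \<open>\<eta> n\<close> sum to at most 1. Both sums obey the moment bound with the
  common majorant \<open>s n = r n + \<eta> n\<close>.\<close>

lemma counting_second_moment:
  obtains D where "D > 0" "\<And>\<gamma> r N. (\<And>n. n \<ge> 1 \<Longrightarrow> 0 \<le> r n \<and> r n \<le> 1 / 2) \<Longrightarrow>
    (LINT x|\<mu>. ((\<Sum>n=1..N. of_bool (int_dist (real (q n) * x - \<gamma>) \<le> r n)) - 2 * (\<Sum>n=1..N. r n))\<^sup>2)
      \<le> D * (1 + (\<Sum>n=1..N. r n))"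
proof -
  obtain D where D: "D > 0" "\<And>\<gamma> h s N. (\<And>n. n \<ge> 1 \<Longrightarrow> \<bar>h n\<bar> \<le> s n) \<Longrightarrow>
    (LINT x|\<mu>. (\<Sum>n=1..N. window_osc q \<gamma> h n x)\<^sup>2) \<le> D * (1 + (\<Sum>n=1..N. s n))"
    using window_osc_second_moment by blast
  show ?thesis
  proof
    \<comment> \<open>Here 9408 = 3 * 56^2, and 12 D = 3 * 2 * 2 D comes from two oscillating sums
      with second moment at most \<open>D * (2 + \<Psi>)\<close> each.\<close>
    show "9408 + 12 * D > 0" using D by simp
    fix \<gamma> :: real and r :: "nat \<Rightarrow> real" and N :: nat
    assume r: "\<And>n. n \<ge> 1 \<Longrightarrow> 0 \<le> r n \<and> r n \<le> 1 / 2"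
    define \<eta> where "\<eta> n = 1 / (real n + 1)\<^sup>2" for n :: nat
    define \<Psi> where "\<Psi> = (\<Sum>n=1..N. r n)"
    define U where "U x = (\<Sum>n=1..N. window_osc q \<gamma> (\<lambda>n. r n + \<eta> n) n x)" for x
    define L where "L x = (\<Sum>n=1..N. window_osc q \<gamma> (\<lambda>n. r n - \<eta> n) n x)" for x
    define T where "T x = (\<Sum>n=1..N. of_bool (int_dist (real (q n) * x - \<gamma>) \<le> r n)) - 2 * (\<Sum>n=1..N. r n)" for x
    have \<Psi>0: "\<Psi> \<ge> 0" unfolding \<Psi>_def using r by (intro sum_nonneg) auto
    have \<eta>s: "(\<Sum>n=1..N. \<eta> n) \<le> 1" unfolding \<eta>_def by (rule sum_inverse_Suc_square_le)
    have \<eta>0: "\<eta> n \<ge> 0" for n by (simp add: \<eta>_def)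
    have T: "T x = (\<Sum>n=1..N. of_bool (int_dist (real (q n) * x - \<gamma>) \<le> r n) - 2 * r n)" for x
      unfolding T_def by (simp only: sum_subtractf sum_distrib_left)
    have TU: "T x \<le> U x + 56" for x
    proof -
      have "T x \<le> (\<Sum>n=1..N. window_osc q \<gamma> (\<lambda>n. r n + \<eta> n) n x + 56 * \<eta> n)"
        unfolding T \<eta>_def using r by (intro sum_mono window_osc_sandwich(1)) auto
      also have "\<dots> = U x + 56 * (\<Sum>n=1..N. \<eta> n)" unfolding U_def by (simp only: sum.distrib sum_distrib_left)
      finally show ?thesis using \<eta>s by linarith
    qed
    have LT: "L x - 56 \<le> T x" for x
    proof -
      have "L x - 56 \<le> L x - 56 * (\<Sum>n=1..N. \<eta> n)" using \<eta>s by linarith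
      also have "\<dots> = (\<Sum>n=1..N. window_osc q \<gamma> (\<lambda>n. r n - \<eta> n) n x - 56 * \<eta> n)"
        unfolding L_def by (simp only: sum_subtractf sum_distrib_left)
      also have "\<dots> \<le> T x"
        unfolding T \<eta>_def using r by (intro sum_mono window_osc_sandwich(2)) auto
      finally show ?thesis .
    qed
    have T2: "(T x)\<^sup>2 \<le> 3 * ((U x)\<^sup>2 + (L x)\<^sup>2 + 3136)" for x
    proof -
      have "\<bar>T x\<bar> \<le> \<bar>U x\<bar> + \<bar>L x\<bar> + 56" using TU[of x] LT[of x] by linarith
      then have "\<bar>T x\<bar>\<^sup>2 \<le> (\<bar>U x\<bar> + \<bar>L x\<bar> + 56)\<^sup>2" by (intro power_mono) auto
      also have "\<dots> \<le> 3 * (\<bar>U x\<bar>\<^sup>2 + \<bar>L x\<bar>\<^sup>2 + 56\<^sup>2)" by (rule power2_sum3_le)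
      finally show ?thesis by simp
    qed
    have osc: "integrable \<mu> (\<lambda>x. (\<Sum>n=1..N. window_osc q \<gamma> h n x)\<^sup>2)" for h
    proof (rule integrable_bounded)
      show "(\<lambda>x. (\<Sum>n=1..N. window_osc q \<gamma> h n x)\<^sup>2) \<in> borel_measurable borel" by measurable
      fix x
      have "\<bar>\<Sum>n=1..N. window_osc q \<gamma> h n x\<bar> \<le> (\<Sum>n=1..N. (\<Sum>k=1..(n + 1) ^ 8. \<bar>window_coeff ((n + 1) ^ 8) (h n) k\<bar>))"
        by (rule order_trans[OF sum_abs]) (intro sum_mono window_osc_bounded)
      then show "\<bar>(\<Sum>n=1..N. window_osc q \<gamma> h n x)\<^sup>2\<bar> \<le> (\<Sum>n=1..N. (\<Sum>k=1..(n + 1) ^ 8. \<bar>window_coeff ((n + 1) ^ 8) (h n) k\<bar>))\<^sup>2"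
        unfolding power_abs by (intro power_mono) auto
    qed
    have U2: "integrable \<mu> (\<lambda>x. (U x)\<^sup>2)" and L2: "integrable \<mu> (\<lambda>x. (L x)\<^sup>2)"
      unfolding U_def L_def by (rule osc)+
    have UD: "(LINT x|\<mu>. (U x)\<^sup>2) \<le> D * (1 + (\<Sum>n=1..N. r n + \<eta> n))"
      unfolding U_def using r \<eta>0 by (intro D(2)) auto
    have LD: "(LINT x|\<mu>. (L x)\<^sup>2) \<le> D * (1 + (\<Sum>n=1..N. r n + \<eta> n))"
    proof -
      have "\<bar>r n - \<eta> n\<bar> \<le> r n + \<eta> n" if "n \<ge> 1" for n using r[OF that] \<eta>0[of n] by linarith
      then show ?thesis unfolding L_def by (intro D(2)) auto
    qed
    have "D * (1 + (\<Sum>n=1..N. r n + \<eta> n)) \<le> D * (2 + \<Psi>)"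
      using \<eta>s D(1) by (simp add: sum.distrib \<Psi>_def)
    then have UL: "(LINT x|\<mu>. (U x)\<^sup>2) \<le> D * (2 + \<Psi>)" "(LINT x|\<mu>. (L x)\<^sup>2) \<le> D * (2 + \<Psi>)"
      using UD LD by linarith+
    have "(LINT x|\<mu>. (T x)\<^sup>2) \<le> (LINT x|\<mu>. 3 * ((U x)\<^sup>2 + (L x)\<^sup>2 + 3136))"
      using U2 L2 by (intro integral_mono' T2) auto
    also have "\<dots> = 3 * ((LINT x|\<mu>. (U x)\<^sup>2) + (LINT x|\<mu>. (L x)\<^sup>2) + 3136)"
      using U2 L2 prob_space by simp
    also have "\<dots> \<le> 3 * (D * (2 + \<Psi>) + D * (2 + \<Psi>) + 3136)"
      using UL by (intro mult_left_mono add_mono) auto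
    also have "\<dots> \<le> (9408 + 12 * D) * (1 + \<Psi>)"
      using D(1) \<Psi>0 by (simp add: algebra_simps)
    finally show "(LINT x|\<mu>. ((\<Sum>n=1..N. of_bool (int_dist (real (q n) * x - \<gamma>) \<le> r n)) - 2 * (\<Sum>n=1..N. r n))\<^sup>2)
      \<le> (9408 + 12 * D) * (1 + (\<Sum>n=1..N. r n))" by (simp add: T_def \<Psi>_def)
  qed
qed

end

section \<open>From second moments to almost sure deviations\<close>

text \<open>As ln (t + 1) - ln t \<ge> 1 / (t + 1), the difference 1 / ln t - 1 / ln (t + 1)
  dominates the term at t + 1, so the series shifted by one telescopes.\<close>

lemma summable_inverse_mult_ln_square:
  "summable (\<lambda>j. 1 / (real (j + 2) * (ln (real (j + 2)))\<^sup>2))"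
proof -
  define f where "f j = 1 / ln (real (j + 2))" for j
  have "f \<longlonglongrightarrow> 0"
    unfolding f_def
    by real_asymp
  then have "summable (\<lambda>j. f j - f (Suc j))"
    by (rule telescope_summable')
  then have "summable (\<lambda>j. 1 / (real (Suc j + 2) * (ln (real (Suc j + 2)))\<^sup>2))"
  proof (rule summable_comparison_test_ev[rotated], intro always_eventually allI)
    fix j
    define t where "t = real (j + 2)"
    have t: "t \<ge> 2" by (simp add: t_def)
    have ln0: "0 < ln t" "ln t \<le> ln (t + 1)" using t by auto
    have "1 - t / (t + 1) \<le> - ln (t / (t + 1))"
      using ln_le_minus_one[of "t / (t + 1)"] t by simp
    also have "- ln (t / (t + 1)) = ln (t + 1) - ln t" using t by (simp add: ln_div)
    also have "1 - t / (t + 1) = 1 / (t + 1)" using t by (simp add: field_simps)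
    finally have d: "1 / (t + 1) \<le> ln (t + 1) - ln t" .
    have "1 / ((t + 1) * (ln (t + 1))\<^sup>2) = (1 / (t + 1)) / (ln (t + 1) * ln (t + 1))"
      by (simp add: power2_eq_square)
    also have "\<dots> \<le> (ln (t + 1) - ln t) / (ln t * ln (t + 1))"
      using d ln0 by (intro frac_le mult_right_mono) auto
    also have "\<dots> = 1 / ln t - 1 / ln (t + 1)" using ln0 by (simp add: field_simps)
    finally show "norm (1 / (real (Suc j + 2) * (ln (real (Suc j + 2)))\<^sup>2)) \<le> f j - f (Suc j)"
      using t ln0 by (simp add: f_def t_def add_ac)
  qed
  then show ?thesis by (subst (asm) summable_Suc_iff)
qed

text \<open>The pure second moment method: with \<open>t\<^sub>j = j + 2\<close>, Chebyshev's inequality controls the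
  deviation at the first \<open>N\<close> with \<open>\<Psi> N \<ge> t\<^sub>j\<^sup>3\<close>, up to \<open>t\<^sub>j\<^sup>2 ln t\<^sub>j\<close>. The gap between consecutive
  cubes is of the order \<open>t\<^sub>j\<^sup>2 = O(\<Psi>\<^sup>2\<^sup>/\<^sup>3)\<close>, so monotonicity in \<open>N\<close> fills the gaps at no extra cost.\<close>

lemma (in prob_space) second_moment_imp_AE_deviation:
  fixes Q :: "nat \<Rightarrow> 'a \<Rightarrow> bool" and r :: "nat \<Rightarrow> real" and D :: real
  assumes meas [measurable]: "\<And>n. Measurable.pred M (Q n)"
    and r: "\<And>n. n \<ge> 1 \<Longrightarrow> 0 < r n \<and> r n \<le> 1 / 2" and D: "D > 0"
    and moment: "\<And>N. expectation (\<lambda>x. ((\<Sum>n=1..N. of_bool (Q n x)) - 2 * (\<Sum>n=1..N. r n))\<^sup>2)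
      \<le> D * (1 + (\<Sum>n=1..N. r n))"
  shows "AE x in M. (\<lambda>N. (\<Sum>n=1..N. of_bool (Q n x)) - 2 * (\<Sum>n=1..N. r n))
    \<in> O(\<lambda>N. (\<Sum>n=1..N. r n) powr (2 / 3) * ln ((\<Sum>n=1..N. r n) + 2))"
proof -
  define \<Psi> where "\<Psi> N = (\<Sum>n=1..N. r n)" for N
  define R where "R N x = (\<Sum>n=1..N. of_bool (Q n x) :: real)" for N x
  have R_meas [measurable]: "random_variable borel (R N)" for N unfolding R_def by measurable
  have R_bound: "\<bar>R N x\<bar> \<le> real N" for N x
    unfolding R_def by (rule order_trans[OF sum_abs]) (rule order_trans[OF sum_bounded_above[of _ _ 1]], auto)
  have R_mono: "R N x \<le> R N' x" if "N \<le> N'" for N N' x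
    unfolding R_def using that by (intro sum_mono2) auto
  have R0: "0 \<le> R N x" for N x unfolding R_def by (intro sum_nonneg) auto
  have \<Psi>_mono: "\<Psi> N \<le> \<Psi> N'" if "N \<le> N'" for N N'
    unfolding \<Psi>_def using that r by (intro sum_mono2) (auto intro: less_imp_le)
  have \<Psi>0: "0 \<le> \<Psi> N" for N using \<Psi>_mono[of 0 N] by (simp add: \<Psi>_def)
  have int2: "integrable M (\<lambda>x. (R N x - c)\<^sup>2)" for N c
  proof (rule integrable_const_bound[of _ "(real N + \<bar>c\<bar>)\<^sup>2"])
    have "\<bar>R N x - c\<bar> \<le> real N + \<bar>c\<bar>" for x using R_bound[of N x] by linarith
    then show "AE x in M. norm ((R N x - c)\<^sup>2) \<le> (real N + \<bar>c\<bar>)\<^sup>2"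
      by (intro AE_I2) (simp flip: abs_le_square_iff)
  qed measurable
  have intR: "integrable M (R N)" for N
    by (rule integrable_const_bound[of _ "real N"]) (use R_bound in auto)
  have mom: "expectation (\<lambda>x. (R N x - 2 * \<Psi> N)\<^sup>2) \<le> D * (1 + \<Psi> N)" for N
    using moment[of N] by (simp add: R_def \<Psi>_def)
  have "AE x in M. (\<lambda>N. R N x - 2 * \<Psi> N) \<in> O(\<lambda>N. \<Psi> N powr (2 / 3) * ln (\<Psi> N + 2))"
  \<comment> \<open>For bounded \<Psi> there are no growing scales to sample along, but then the
    probabilities of the events are summable: almost surely only finitely many occur, and the
    deviation stays bounded.\<close>
  proof (cases "\<exists>P. \<forall>N. \<Psi> N \<le> P")
    case True
    then obtain P where P: "\<And>N. \<Psi> N \<le> P" by blast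
    have probQ: "prob {x \<in> space M. Q n x} = expectation (\<lambda>x. of_bool (Q n x))" for n
    proof -
      have "expectation (\<lambda>x. of_bool (Q n x) :: real) = expectation (indicator {x \<in> space M. Q n x})"
        by (intro Bochner_Integration.integral_cong) (auto simp: indicator_def)
      then show ?thesis by (simp add: Bochner_Integration.integral_indicator)
    qed
    have intQ: "integrable M (\<lambda>x. of_bool (Q n x) :: real)" for n
      by (rule integrable_const_bound[of _ 1]) auto
    \<comment> \<open>The second moment controls the mean through y \<le> 1 + y^2.\<close>
    have partial: "(\<Sum>n=1..N. prob {x \<in> space M. Q n x}) \<le> 2 * P + 1 + D * (1 + P)" for N
    proof -
      have "R N x \<le> (2 * P + 1) + (R N x - 2 * \<Psi> N)\<^sup>2" for x
      proof -
        have "y \<le> 1 + y\<^sup>2" for y :: real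
          using zero_le_power2[of "y - 1 / 2"] by (simp add: power2_eq_square algebra_simps)
        then have "R N x - 2 * \<Psi> N \<le> 1 + (R N x - 2 * \<Psi> N)\<^sup>2" .
        then show ?thesis using P[of N] by linarith
      qed
      then have "expectation (R N) \<le> expectation (\<lambda>x. (2 * P + 1) + (R N x - 2 * \<Psi> N)\<^sup>2)"
        using int2[of N] intR by (intro integral_mono) auto
      also have "\<dots> = (2 * P + 1) + expectation (\<lambda>x. (R N x - 2 * \<Psi> N)\<^sup>2)"
        using int2[of N "2 * \<Psi> N"] by (simp add: prob_space)
      also have "\<dots> \<le> (2 * P + 1) + D * (1 + P)"
        by (rule add_left_mono, rule order_trans[OF mom], rule mult_left_mono) (use D P[of N] in auto)
      also have "expectation (R N) = (\<Sum>n=1..N. prob {x \<in> space M. Q n x})"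
        unfolding R_def probQ using intQ by (intro Bochner_Integration.integral_sum)
      finally show ?thesis .
    qed
    have "summable (\<lambda>n. prob {x \<in> space M. Q (Suc n) x})"
    proof (rule bounded_imp_summable)
      fix N
      show "(\<Sum>n\<le>N. prob {x \<in> space M. Q (Suc n) x}) \<le> 2 * P + 1 + D * (1 + P)"
        using partial[of "Suc N"] sum.shift_bounds_cl_Suc_ivl[of "\<lambda>n. prob {x \<in> space M. Q n x}" 0 N]
        by (simp add: atMost_atLeast0)
    qed simp
    then have "summable (\<lambda>n. prob {x \<in> space M. Q n x})" by (subst (asm) summable_Suc_iff)
    then have "AE x in M. \<forall>\<^sub>F n in sequentially. x \<in> space M - {x \<in> space M. Q n x}"
      by (intro borel_cantelli_AE1) (auto simp: emeasure_eq_measure)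
    then show ?thesis
    proof (rule AE_mp, intro AE_I2 impI)
      fix x assume x: "x \<in> space M" "\<forall>\<^sub>F n in sequentially. x \<in> space M - {x \<in> space M. Q n x}"
      then obtain n0 where n0: "\<And>n. n \<ge> n0 \<Longrightarrow> \<not> Q n x"
        by (auto simp: eventually_sequentially)
      have Rle: "R N x \<le> real n0" for N
      proof -
        have "R N x \<le> (\<Sum>n=1..N. of_bool (n < n0))"
          unfolding R_def using n0 by (intro sum_mono) (force simp: not_le[symmetric])
        also have "\<dots> = real (card ({1..N} \<inter> {n. n < n0}))" by simp
        also have "card ({1..N} \<inter> {n. n < n0}) \<le> card {..<n0}" by (intro card_mono) auto
        finally show ?thesis by simp
      qed
      \<comment> \<open>A lower bound for the comparison function from \<open>N = 1\<close> on,
        positive because \<open>r 1 > 0\<close>.\<close>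
      define c where "c = r 1 powr (2 / 3) * ln 2"
      have c: "c > 0" using r[of 1] by (simp add: c_def)
      show "(\<lambda>N. R N x - 2 * \<Psi> N) \<in> O(\<lambda>N. \<Psi> N powr (2 / 3) * ln (\<Psi> N + 2))"
      proof (rule bigoI[where c = "(real n0 + 2 * P) / c"], rule eventually_sequentiallyI[of 1])
        fix N :: nat assume "1 \<le> N"
        then have "r 1 \<le> \<Psi> N" using \<Psi>_mono[of 1 N] by (simp add: \<Psi>_def)
        then have "c \<le> \<Psi> N powr (2 / 3) * ln (\<Psi> N + 2)"
          unfolding c_def using r[of 1] by (intro mult_mono powr_mono2) auto
        moreover have "\<bar>R N x - 2 * \<Psi> N\<bar> \<le> real n0 + 2 * P"
          using Rle[of N] R0[of N x] P[of N] \<Psi>0[of N] by linarith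
        moreover have "0 \<le> (real n0 + 2 * P) / c" using P[of 0] \<Psi>0[of 0] c by simp
        ultimately have "\<bar>R N x - 2 * \<Psi> N\<bar> * 1 \<le> (real n0 + 2 * P) / c * (\<Psi> N powr (2 / 3) * ln (\<Psi> N + 2))"
          using c mult_left_mono[of c "\<Psi> N powr (2 / 3) * ln (\<Psi> N + 2)" "(real n0 + 2 * P) / c"] by simp
        then show "norm (R N x - 2 * \<Psi> N) \<le> (real n0 + 2 * P) / c * norm (\<Psi> N powr (2 / 3) * ln (\<Psi> N + 2))"
          using \<Psi>0[of N] by (simp add: abs_mult)
      qed
    qed
  next
    case False
    then have unb: "\<exists>N. c \<le> \<Psi> N" for c by (meson linear)
    define t where "t j = real (j + 2)" for j :: nat
    define \<nu> where "\<nu> j = (LEAST N. t j ^ 3 \<le> \<Psi> N)" for j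
    have t2: "t j \<ge> 2" for j by (simp add: t_def)
    have \<nu>_ge: "t j ^ 3 \<le> \<Psi> (\<nu> j)" for j unfolding \<nu>_def by (rule LeastI_ex) (rule unb)
    \<comment> \<open>By minimality \<Psi> has only just crossed \<open>t j ^ 3\<close>, and a
      single step adds at most 1/2.\<close>
    have \<nu>_le: "\<Psi> (\<nu> j) \<le> t j ^ 3 + 1" for j
    proof (cases "\<nu> j")
      case 0
      then show ?thesis using t2[of j] by (simp add: \<Psi>_def)
    next
      case (Suc N)
      then have "\<Psi> N < t j ^ 3" using not_less_Least[of N "\<lambda>N. t j ^ 3 \<le> \<Psi> N"] by (simp add: \<nu>_def not_le)
      then show ?thesis using r[of "Suc N"] by (simp add: Suc \<Psi>_def)
    qed
    \<comment> \<open>A second moment of order t^3 divided by e^2 has order 1 / (t (ln t)^2), which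
      is barely summable.\<close>
    define e where "e j = t j ^ 2 * ln (t j)" for j
    have e0: "e j > 0" for j using t2[of j] by (simp add: e_def)
    define Z where "Z j = {x \<in> space M. e j \<le> \<bar>R (\<nu> j) x - 2 * \<Psi> (\<nu> j)\<bar>}" for j
    have [measurable]: "Z j \<in> events" for j unfolding Z_def by measurable
    have pZ: "prob (Z j) \<le> 2 * D * (1 / (t j * (ln (t j))\<^sup>2))" for j
    proof -
      have "prob (Z j) \<le> expectation (\<lambda>x. (R (\<nu> j) x - 2 * \<Psi> (\<nu> j))\<^sup>2) / (e j)\<^sup>2"
        unfolding Z_def by (intro second_moment_method int2 e0) measurable
      also have "\<dots> \<le> D * (2 * t j ^ 3) / (e j)\<^sup>2"
      proof (intro divide_right_mono)
        have "2 ^ 3 \<le> t j ^ 3" using t2[of j] by (intro power_mono) auto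
        then have "D * (1 + \<Psi> (\<nu> j)) \<le> D * (2 * t j ^ 3)" using D \<nu>_le[of j] by (intro mult_left_mono) auto
        then show "expectation (\<lambda>x. (R (\<nu> j) x - 2 * \<Psi> (\<nu> j))\<^sup>2) \<le> D * (2 * t j ^ 3)"
          using mom[of "\<nu> j"] by linarith
      qed simp
      also have "\<dots> = 2 * D * (1 / (t j * (ln (t j))\<^sup>2))"
        using t2[of j] by (simp add: e_def field_simps power2_eq_square power3_eq_cube)
      finally show ?thesis .
    qed
    have "summable (\<lambda>j. prob (Z j))"
    proof (rule summable_comparison_test')
      show "summable (\<lambda>j. 2 * D * (1 / (t j * (ln (t j))\<^sup>2)))"
        unfolding t_def by (intro summable_mult summable_inverse_mult_ln_square)
    qed (use pZ in simp)
    then have "AE x in M. \<forall>\<^sub>F j in sequentially. x \<in> space M - Z j"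
      by (intro borel_cantelli_AE1) (auto simp: emeasure_eq_measure)
    then show ?thesis
    proof (rule AE_mp, intro AE_I2 impI)
      fix x assume x: "x \<in> space M" "\<forall>\<^sub>F j in sequentially. x \<in> space M - Z j"
      then obtain J where J: "\<And>j. j \<ge> J \<Longrightarrow> \<bar>R (\<nu> j) x - 2 * \<Psi> (\<nu> j)\<bar> < e j"
        unfolding eventually_sequentially Z_def by fastforce
      obtain N0 where N0: "(real J + 3) ^ 3 \<le> \<Psi> N0" using unb by blast
      show "(\<lambda>N. R N x - 2 * \<Psi> N) \<in> O(\<lambda>N. \<Psi> N powr (2 / 3) * ln (\<Psi> N + 2))"
      proof (rule bigoI[where c = 14], rule eventually_sequentiallyI[of N0])
        fix N assume "N0 \<le> N"
        then have N: "(real J + 3) ^ 3 \<le> \<Psi> N" using \<Psi>_mono[of N0 N] N0 by linarith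
        define p where "p = \<Psi> N powr (1 / 3)"
        have \<Psi>pos: "\<Psi> N > 0" using N zero_less_power[of "real J + 3" 3] by linarith
        have p3: "p ^ 3 = \<Psi> N" using \<Psi>pos by (simp add: p_def powr_powr flip: powr_realpow)
        have pge: "real J + 3 \<le> p"
        proof (rule power_le_imp_le_base[of _ 2])
          show "(real J + 3) ^ Suc 2 \<le> p ^ Suc 2" using N p3 by (simp add: eval_nat_numeral)
        qed (simp add: p_def)
        \<comment> \<open>Makes \<open>t j\<close> the integer part of \<open>p\<close>, the cube
          root of \<open>\<Psi> N\<close>; the choice of \<open>N0\<close> ensures
          \<open>J \<le> j\<close>.\<close>
        define j where "j = nat \<lfloor>p\<rfloor> - 2"
        have tj: "t j \<le> p" "p < t j + 1" "J \<le> j"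
        proof -
          have "int J + 3 \<le> \<lfloor>p\<rfloor>" using pge by (simp add: le_floor_iff)
          then have "real (j + 2) = of_int \<lfloor>p\<rfloor>" "J \<le> j" by (auto simp: j_def)
          then show "t j \<le> p" "p < t j + 1" "J \<le> j" unfolding t_def by linarith+
        qed
        define u where "u = t j"
        have u: "u \<ge> 2" using t2 by (simp add: u_def)
        have tS: "t (Suc j) = u + 1" by (simp add: t_def u_def)
        have lo: "u ^ 3 \<le> \<Psi> N" using power_mono[OF tj(1), of 3] u p3 by (simp add: u_def)
        have hi: "\<Psi> N < (u + 1) ^ 3" using power_strict_mono[OF tj(2), of 3] p3 pge by (simp add: u_def)
        have "\<nu> j \<le> N" unfolding \<nu>_def using lo by (intro Least_le) (simp add: u_def)
        then have R1: "R (\<nu> j) x \<le> R N x" by (rule R_mono)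
        have "N \<le> \<nu> (Suc j)"
        proof (rule ccontr)
          assume "\<not> N \<le> \<nu> (Suc j)"
          then have "\<Psi> (\<nu> (Suc j)) \<le> \<Psi> N" by (intro \<Psi>_mono) simp
          then show False using hi \<nu>_ge[of "Suc j"] by (simp add: tS)
        qed
        then have R2: "R N x \<le> R (\<nu> (Suc j)) x" by (rule R_mono)
        have b1: "2 * u ^ 3 - u\<^sup>2 * ln u \<le> R N x"
          using R1 J[OF tj(3)] \<nu>_ge[of j] by (simp add: e_def u_def abs_less_iff)
        have b2: "R N x \<le> 2 * (u + 1) ^ 3 + 2 + (u + 1)\<^sup>2 * ln (u + 1)"
          using R2 J[of "Suc j"] tj(3) \<nu>_le[of "Suc j"] by (simp add: e_def tS abs_less_iff)
        define l where "l = ln (\<Psi> N + 2)"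
        have uu: "u \<le> u ^ 3" using u by (intro self_le_power) auto
        have lu: "ln u \<le> l" "ln (u + 1) \<le> l" unfolding l_def using u uu lo by (auto intro!: ln_mono)
        have l1: "1 \<le> l"
        proof -
          have "exp 1 \<le> \<Psi> N + 2" using exp_le uu lo u by linarith
          then show ?thesis unfolding l_def using \<Psi>pos by (simp add: ln_ge_iff)
        qed
        have q1: "u\<^sup>2 * ln u \<le> u\<^sup>2 * l" using lu by (intro mult_left_mono) auto
        have "2 * u \<le> u * u" using u by (intro mult_right_mono) auto
        then have us: "2 * u \<le> u\<^sup>2" "4 \<le> u\<^sup>2" using u unfolding power2_eq_square by linarith+
        then have "(u + 1)\<^sup>2 \<le> 4 * u\<^sup>2" by (simp add: power2_sum)
        then have "(u + 1)\<^sup>2 * ln (u + 1) \<le> 4 * u\<^sup>2 * l" using lu u by (intro mult_mono) auto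
        then have q2: "(u + 1)\<^sup>2 * ln (u + 1) \<le> 4 * (u\<^sup>2 * l)" by (simp only: mult.assoc)
        have cube: "(u + 1) ^ 3 = u ^ 3 + 3 * u\<^sup>2 + 3 * u + 1" by (simp add: power3_eq_cube power2_eq_square algebra_simps)
        have ul: "u\<^sup>2 \<le> u\<^sup>2 * l" using l1 by (simp add: mult_le_cancel_left1)
        have "\<bar>R N x - 2 * \<Psi> N\<bar> \<le> 14 * (u\<^sup>2 * l)"
        proof -
          \<comment> \<open>To be read with a = u^3, b = u^2, w = u^2 l, and d, d' the deviations
            allowed at the two sampled points. The upper estimate costs 6 + 3 + 1 + 4 = 14 multiples
            of w, the lower one fewer.\<close>
          have lin: "\<bar>y - 2 * z\<bar> \<le> 14 * w"
            if "2 * a - d \<le> y" "y \<le> 2 * (a + 3 * b + 3 * u + 1) + 2 + d'" "a \<le> z"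
              "z < a + 3 * b + 3 * u + 1" "d \<le> w" "d' \<le> 4 * w" "2 * u \<le> b" "4 \<le> b" "b \<le> w"
            for a b d d' w y z :: real
            using that by (intro abs_leI; argo)
          show ?thesis by (rule lin[OF b1 b2[unfolded cube] lo hi[unfolded cube] q1 q2 us ul])
        qed
        also have "u\<^sup>2 \<le> \<Psi> N powr (2 / 3)"
        proof -
          have "u\<^sup>2 \<le> p\<^sup>2" using tj u by (intro power_mono) (auto simp: u_def)
          also have "p\<^sup>2 = \<Psi> N powr (2 / 3)" using \<Psi>pos by (simp add: p_def powr_powr flip: powr_realpow)
          finally show ?thesis .
        qed
        then have "14 * (u\<^sup>2 * l) \<le> 14 * (\<Psi> N powr (2 / 3) * l)" using l1 by (intro mult_left_mono mult_right_mono) auto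
        finally show "norm (R N x - 2 * \<Psi> N) \<le> 14 * norm (\<Psi> N powr (2 / 3) * ln (\<Psi> N + 2))"
          using l1 by (simp add: l_def abs_mult)
      qed
    qed
  qed
  then show ?thesis by (simp add: R_def \<Psi>_def)
qed

section \<open>Fourier decay along lacunary sequences, and the conclusion\<close>

text \<open>Since q_n \<ge> K^(n - 1), every |t| \<ge> q_n / 2 has logarithm at least (n - 1) ln K -
  ln 2, which is at least n (ln K) / 2 for large n. The remaining n are absorbed into the constant
  because \<rho> \<le> 1.\<close>

lemma lacunary_decay:
  fixes \<rho> :: "real \<Rightarrow> real" and q :: "nat \<Rightarrow> nat"
  assumes K: "K > 1" and q_pos: "\<And>n. n \<ge> 1 \<Longrightarrow> q n > 0"
    and q_Suc: "\<And>n. n \<ge> 1 \<Longrightarrow> K * real (q n) \<le> real (q (Suc n))"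
    and \<rho>: "\<And>t. 0 \<le> \<rho> t" "\<And>t. \<rho> t \<le> 1" and A: "A > 0"
    and bigo: "\<rho> \<in> O[at_infinity](\<lambda>t. (ln \<bar>t\<bar>) powr (- A))"
  obtains B where "B > 0" "\<And>n t. n \<ge> 1 \<Longrightarrow> real (q n) / 2 \<le> \<bar>t\<bar> \<Longrightarrow> \<rho> t \<le> B * real n powr (- A)"
proof -
  obtain c where c: "c > 0" "\<forall>\<^sub>F t in at_infinity. norm (\<rho> t) \<le> c * norm ((ln \<bar>t\<bar>) powr (- A))"
    using landau_o.bigE[OF bigo] by blast
  then obtain b where b: "\<And>t. b \<le> \<bar>t\<bar> \<Longrightarrow> \<rho> t \<le> c * (ln \<bar>t\<bar>) powr (- A)"
    using \<rho> by (auto simp: eventually_at_infinity)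
  define \<kappa> where "\<kappa> = ln K / 2"
  have \<kappa>: "\<kappa> > 0" using K by (simp add: \<kappa>_def)
  have qK: "K ^ j \<le> real (q (Suc j))" for j
  proof (induction j)
    case 0
    then show ?case using q_pos[of 1] by simp
  next
    case (Suc j)
    then have "K * K ^ j \<le> K * real (q (Suc j))" using K by (intro mult_left_mono) auto
    then show ?case using q_Suc[of "Suc j"] by simp
  qed
  \<comment> \<open>The first condition gives 2 \<kappa> (n - 1) - ln 2 \<ge> \<kappa> n for n \<ge>
    n0; the second puts \<kappa> n, hence exp (\<kappa> n) and |t|, beyond the threshold
    \<open>b\<close>.\<close>
  obtain n0 :: nat where n0: "(2 * \<kappa> + ln 2) / \<kappa> \<le> real n0" "b / \<kappa> \<le> real n0" "1 \<le> n0"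
  proof
    let ?n = "nat \<lceil>(2 * \<kappa> + ln 2) / \<kappa>\<rceil> + nat \<lceil>b / \<kappa>\<rceil> + 1"
    show "(2 * \<kappa> + ln 2) / \<kappa> \<le> real ?n" "b / \<kappa> \<le> real ?n" "1 \<le> ?n" by linarith+
  qed
  define B where "B = c * \<kappa> powr (- A) + real n0 powr A"
  show ?thesis
  proof
    show "B > 0" unfolding B_def using c n0 by (intro add_nonneg_pos) auto
    fix n :: nat and t :: real
    assume n: "n \<ge> 1" and t: "real (q n) / 2 \<le> \<bar>t\<bar>"
    show "\<rho> t \<le> B * real n powr (- A)"
    proof (cases "n0 \<le> n")
      case True
      have "2 * \<kappa> + ln 2 \<le> \<kappa> * real n0" "b \<le> \<kappa> * real n0" using n0 \<kappa> by (auto simp: field_simps)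
      moreover have "\<kappa> * real n0 \<le> \<kappa> * real n" using True \<kappa> by simp
      ultimately have le: "2 * \<kappa> + ln 2 \<le> \<kappa> * real n" "b \<le> \<kappa> * real n" by linarith+
      have "exp (\<kappa> * real n) \<le> exp (real (n - 1) * ln K - ln 2)"
        using le(1) n by (simp add: \<kappa>_def of_nat_diff algebra_simps)
      also have "\<dots> = K ^ (n - 1) / 2" using K by (simp add: exp_diff exp_of_nat_mult)
      also have "\<dots> \<le> real (q n) / 2" using qK[of "n - 1"] n by simp
      finally have ext: "exp (\<kappa> * real n) \<le> \<bar>t\<bar>" using t by linarith
      have "\<kappa> * real n \<le> exp (\<kappa> * real n)" using exp_ge_add_one_self[of "\<kappa> * real n"] by linarith
      then have bt: "b \<le> \<bar>t\<bar>" using le ext by linarith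
      have tpos: "\<bar>t\<bar> > 0" using ext exp_gt_zero[of "\<kappa> * real n"] by linarith
      have "\<kappa> * real n \<le> ln \<bar>t\<bar>" using ext tpos by (subst ln_ge_iff) auto
      then have "(ln \<bar>t\<bar>) powr (- A) \<le> (\<kappa> * real n) powr (- A)"
        using \<kappa> n A by (intro powr_mono2') auto
      also have "\<dots> = \<kappa> powr (- A) * real n powr (- A)" using \<kappa> by (simp add: powr_mult)
      finally have "c * (ln \<bar>t\<bar>) powr (- A) \<le> c * (\<kappa> powr (- A) * real n powr (- A))"
        using c by (intro mult_left_mono) auto
      with b[OF bt] have "\<rho> t \<le> c * \<kappa> powr (- A) * real n powr (- A)" by (simp add: mult.assoc)
      also have "\<dots> \<le> B * real n powr (- A)" by (intro mult_right_mono) (auto simp: B_def)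
      finally show ?thesis .
    next
      case False
      have "real n powr A * real n powr (- A) = 1" using n by (simp flip: powr_add)
      moreover have "real n powr A * real n powr (- A) \<le> B * real n powr (- A)"
      proof (intro mult_right_mono)
        have "real n powr A \<le> real n0 powr A" using False A by (intro powr_mono2) auto
        moreover have "0 \<le> c * \<kappa> powr (- A)" using c by simp
        ultimately show "real n powr A \<le> B" unfolding B_def by linarith
      qed simp
      ultimately show ?thesis using \<rho>(2)[of t] by linarith
    qed
  qed
qed

theorem theorem1:
  fixes \<mu> :: "real measure" and F :: "real set" and q :: "nat \<Rightarrow> nat"
    and \<psi> :: "nat \<Rightarrow> real" and \<gamma> A \<epsilon> :: real
  assumes "prob_space \<mu>" and "sets \<mu> = sets borel"
    and "F \<subseteq> {0..1}" and "AE x in \<mu>. x \<in> F"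
    and "\<forall>n\<ge>1. q n > 0" and "lacunary q"
    and "\<gamma> \<in> {0..1}"
    and "\<forall>m\<ge>1. 0 < \<psi> m \<and> \<psi> m \<le> 1"
    and "\<forall>n\<ge>1. \<psi> (q n) \<le> 1 / 2"
    and "A > 2"
    and "(\<lambda>t. norm (fourier_transform \<mu> t)) \<in> O[at_infinity](\<lambda>t. (ln \<bar>t\<bar>) powr (- A))"
    and "\<epsilon> > 0"
  shows "AE x in \<mu>. x \<in> F \<longrightarrow>
    (\<lambda>N. real (counting q \<psi> \<gamma> x N) - 2 * psi_sum q \<psi> N)
      \<in> O(\<lambda>N. psi_sum q \<psi> N powr (2 / 3) * (ln (psi_sum q \<psi> N + 2)) powr (2 + \<epsilon>))"
proof -
  interpret prob_space \<mu> by fact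
  obtain K where K: "K > 1" "\<And>n. n \<ge> 1 \<Longrightarrow> K \<le> real (q (Suc n)) / real (q n)"
    using \<open>lacunary q\<close> by (auto simp: lacunary_def)
  have q_pos: "q n > 0" if "n \<ge> 1" for n using assms(5) that by blast
  have q_Suc: "K * real (q n) \<le> real (q (Suc n))" if "n \<ge> 1" for n
    using K(2)[OF that] q_pos[OF that] by (simp add: field_simps)
  obtain B where B: "B > 0" "\<And>n t. n \<ge> 1 \<Longrightarrow> real (q n) / 2 \<le> \<bar>t\<bar> \<Longrightarrow>
      norm (fourier_transform \<mu> t) \<le> B * real n powr (- A)"
    by (rule lacunary_decay[where q = q and A = A and \<rho> = "\<lambda>t. norm (fourier_transform \<mu> t)",
          OF K(1) q_pos q_Suc norm_ge_zero norm_fourier_transform_le_1[OF assms(1)] _ assms(11)])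
       (use \<open>A > 2\<close> in auto)
  interpret fourier_decay \<mu> q K A B
    by unfold_locales (use assms K B q_pos q_Suc in auto)
  have r: "0 < \<psi> (q n) \<and> \<psi> (q n) \<le> 1 / 2" if "n \<ge> 1" for n
    using assms(8,9) q_pos[OF that] that by (simp add: Suc_leI)
  obtain D where D: "D > 0" "\<And>\<gamma> r N. (\<And>n. n \<ge> 1 \<Longrightarrow> 0 \<le> r n \<and> r n \<le> 1 / 2) \<Longrightarrow>
    (LINT x|\<mu>. ((\<Sum>n=1..N. of_bool (int_dist (real (q n) * x - \<gamma>) \<le> r n)) - 2 * (\<Sum>n=1..N. r n))\<^sup>2)
      \<le> D * (1 + (\<Sum>n=1..N. r n))"
    using counting_second_moment by blast
  have count: "real (counting q \<psi> \<gamma> x N) = (\<Sum>n=1..N. of_bool (int_dist (real (q n) * x - \<gamma>) \<le> \<psi> (q n)))" for x N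
    by (simp add: counting_def Int_def)
  have "AE x in \<mu>. (\<lambda>N. (\<Sum>n=1..N. of_bool (int_dist (real (q n) * x - \<gamma>) \<le> \<psi> (q n))) - 2 * (\<Sum>n=1..N. \<psi> (q n)))
    \<in> O(\<lambda>N. (\<Sum>n=1..N. \<psi> (q n)) powr (2 / 3) * ln ((\<Sum>n=1..N. \<psi> (q n)) + 2))"
  proof (rule second_moment_imp_AE_deviation[OF _ r D(1) D(2)])
    show "Measurable.pred \<mu> (\<lambda>x. int_dist (real (q n) * x - \<gamma>) \<le> \<psi> (q n))" for n
      unfolding int_dist_le_iff by measurable
  qed (use r in \<open>auto intro: less_imp_le\<close>)
  then have dev: "AE x in \<mu>. (\<lambda>N. real (counting q \<psi> \<gamma> x N) - 2 * psi_sum q \<psi> N)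
      \<in> O(\<lambda>N. psi_sum q \<psi> N powr (2 / 3) * ln (psi_sum q \<psi> N + 2))"
    by (simp only: count psi_sum_def)
  \<comment> \<open>The logarithm is at least ln 2 > 0, so raising its exponent from 1 to 2 +
    \<epsilon> costs only the factor (ln 2)^(-(1 + \<epsilon>)).\<close>
  have bigo: "(\<lambda>N. psi_sum q \<psi> N powr (2 / 3) * ln (psi_sum q \<psi> N + 2))
      \<in> O(\<lambda>N. psi_sum q \<psi> N powr (2 / 3) * (ln (psi_sum q \<psi> N + 2)) powr (2 + \<epsilon>))"
  proof (intro landau_o.big.mult_left bigoI[where c = "ln 2 powr (- (1 + \<epsilon>))"] always_eventually allI)
    fix N
    define l where "l = ln (psi_sum q \<psi> N + 2)"
    have "0 \<le> psi_sum q \<psi> N" unfolding psi_sum_def using r by (intro sum_nonneg) (auto intro: less_imp_le)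
    then have l: "ln 2 \<le> l" by (simp add: l_def)
    then have l0: "l > 0" using ln_gt_zero[of "2::real"] by linarith
    have "l = l powr (- (1 + \<epsilon>)) * l powr (2 + \<epsilon>)"
      using l0 by (simp flip: powr_add)
    also have "\<dots> \<le> ln 2 powr (- (1 + \<epsilon>)) * l powr (2 + \<epsilon>)"
      using l \<open>\<epsilon> > 0\<close> by (intro mult_right_mono powr_mono2') auto
    finally show "norm (ln (psi_sum q \<psi> N + 2)) \<le> ln 2 powr (- (1 + \<epsilon>)) * norm ((ln (psi_sum q \<psi> N + 2)) powr (2 + \<epsilon>))"
      using l0 by (simp add: l_def)
  qed
  show ?thesis
    using dev by eventually_elim (rule impI, rule landau_o.big_trans[OF _ bigo])
qed

end
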